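(* Let $d\ge3$ and let $\{S_n\}$ be a symmetric aperiodic random walk on $\mathbb{Z}^d$ satisfying the moment condition stated in the context. Let $\varepsilon>0$ and let $\delta_n>0$ be a non-increasing sequence with $\delta_n\to0$ and $\delta_n(\log n)^{1-\varepsilon}\to0$. Put $k_n=(1-\delta_n)\lambda\log n$ and $\mathcal{B}_n=\{0\le j\le n:\xi(S_j,\infty)\ge k_n\}$. For $j\in\mathcal{B}_n$ let $R(n,j)$ denote the largest number (supremum of $r$) such that $S_j+B(r)$ is completely covered by the random walk $S_0,S_1,S_2,\dots$, i.e. $\xi(S_j+x,\infty)>0$ for all $x\in B(r)$. Then almost surely, for all sufficiently large $n$ and all $j\in\mathcal{B}_n$, $$R(n,j)\ge(\log n)^{(1-\varepsilon)/(2d-4)} .$$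
   Context: $S_0=0$, $S_n=\sum_{k=1}^n X_k$, where $X_1,X_2,\dots$ are i.i.d. $\mathbb{Z}^d$-valued with $\mathbf{P}(X_1=x)=p(x)$. Symmetric means $p(x)=p(-x)$ for all $x$. Aperiodic means: with $R^+=\{x\in\mathbb{Z}^d:\mathbf{P}(S_n=x)>0\text{ for some }n\ge0\}$, one has $\{y-z:\ y\in R^+,\,z\in R^+\}=\mathbb{Z}^d$. Moment condition (with $|x|$ the Euclidean norm): $\sum_x|x|^2p(x)<\infty$ if $d=3$; $\sum_x|x|^2\log(|x|+1)p(x)<\infty$ if $d=4$; $\sum_x|x|^{d-2}p(x)<\infty$ if $d\ge5$. $Q$ is the covariance matrix of $X_1$, $\Vert x\Vert^2:=xQ^{-1}x$, and $B(r)=\{x\in\mathbb{Z}^d:\Vert x\Vert\le r\}$. $\gamma:=\mathbf{P}(S_i\ne0,\ i=1,2,\dots)>0$, $\lambda:=-1/\log(1-\gamma)$. Local time: $\xi(x,\infty):=\sum_{k=1}^\infty I\{S_k=x\}$. *)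

theory Defs
  imports "HOL-Probability.Probability"
begin

text \<open>
  Random walks on the lattice of integer vectors \<^typ>\<open>int ^ 'd\<close>, of dimension \<open>CARD('d)\<close>.
  The steps are \<open>X 1, X 2, \<dots>\<close>; the value \<open>X 0\<close> is never used.
\<close>

definition iid_steps :: "'a measure \<Rightarrow> (nat \<Rightarrow> 'a \<Rightarrow> int ^ 'd) \<Rightarrow> (int ^ 'd) pmf \<Rightarrow> bool" where
  "iid_steps M X p \<longleftrightarrow>
     prob_space M \<and>
     prob_space.indep_vars M (\<lambda>_. count_space UNIV) X {1..} \<and>
     (\<forall>k\<ge>1. distr M (count_space UNIV) (X k) = measure_pmf p)"

definition walk :: "(nat \<Rightarrow> 'a \<Rightarrow> int ^ 'd) \<Rightarrow> nat \<Rightarrow> 'a \<Rightarrow> int ^ 'd" where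
  "walk X n \<omega> = (\<Sum>k=1..n. X k \<omega>)"

definition symmetric_law :: "(int ^ 'd) pmf \<Rightarrow> bool" where
  "symmetric_law p \<longleftrightarrow> (\<forall>x. pmf p x = pmf p (- x))"

definition reachable :: "'a measure \<Rightarrow> (nat \<Rightarrow> 'a \<Rightarrow> int ^ 'd) \<Rightarrow> (int ^ 'd) set" where
  "reachable M X = {x. \<exists>n. measure M {\<omega> \<in> space M. walk X n \<omega> = x} > 0}"

definition aperiodic_walk :: "'a measure \<Rightarrow> (nat \<Rightarrow> 'a \<Rightarrow> int ^ 'd) \<Rightarrow> bool" where
  "aperiodic_walk M X \<longleftrightarrow> {y - z | y z. y \<in> reachable M X \<and> z \<in> reachable M X} = UNIV"

definition real_vec :: "int ^ 'd \<Rightarrow> real ^ 'd" where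
  "real_vec x = (\<chi> i. real_of_int (x $ i))"

text \<open>
  All summands are nonnegative, so unconditional summability over the lattice says exactly that
  the sum is finite.
\<close>

definition moment_condition :: "(int ^ 'd) pmf \<Rightarrow> bool" where
  "moment_condition p \<longleftrightarrow>
     (CARD('d) = 3 \<longrightarrow> (\<lambda>x. norm (real_vec x) ^ 2 * pmf p x) summable_on UNIV) \<and>
     (CARD('d) = 4 \<longrightarrow>
        (\<lambda>x. norm (real_vec x) ^ 2 * ln (norm (real_vec x) + 1) * pmf p x) summable_on UNIV) \<and>
     (CARD('d) \<ge> 5 \<longrightarrow> (\<lambda>x. norm (real_vec x) ^ (CARD('d) - 2) * pmf p x) summable_on UNIV)"

definition cov_matrix :: "(int ^ 'd) pmf \<Rightarrow> real ^ 'd ^ 'd" where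
  "cov_matrix p = (\<chi> i j. measure_pmf.expectation p (\<lambda>x.
     (real_vec x $ i - measure_pmf.expectation p (\<lambda>y. real_vec y $ i)) *
     (real_vec x $ j - measure_pmf.expectation p (\<lambda>y. real_vec y $ j))))"

definition cov_norm :: "(int ^ 'd) pmf \<Rightarrow> real ^ 'd \<Rightarrow> real" where
  "cov_norm p x = sqrt (x \<bullet> (matrix_inv (cov_matrix p) *v x))"

definition lattice_ball :: "(int ^ 'd) pmf \<Rightarrow> real \<Rightarrow> (int ^ 'd) set" where
  "lattice_ball p r = {x. cov_norm p (real_vec x) \<le> r}"

definition escape_prob :: "'a measure \<Rightarrow> (nat \<Rightarrow> 'a \<Rightarrow> int ^ 'd) \<Rightarrow> real" where
  "escape_prob M X = measure M {\<omega> \<in> space M. \<forall>i\<ge>1. walk X i \<omega> \<noteq> 0}"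

definition lambda_const :: "'a measure \<Rightarrow> (nat \<Rightarrow> 'a \<Rightarrow> int ^ 'd) \<Rightarrow> real" where
  "lambda_const M X = - 1 / ln (1 - escape_prob M X)"

text \<open>
  The total local time may be infinite on exceptional paths, hence the extended real value.
  Time \<open>0\<close> is not counted.
\<close>

definition local_time :: "(nat \<Rightarrow> 'a \<Rightarrow> int ^ 'd) \<Rightarrow> int ^ 'd \<Rightarrow> 'a \<Rightarrow> ereal" where
  "local_time X x \<omega> = (\<Sum>k. if walk X (Suc k) \<omega> = x then 1 else 0)"

definition heavy_times ::
    "(nat \<Rightarrow> 'a \<Rightarrow> int ^ 'd) \<Rightarrow> (nat \<Rightarrow> real) \<Rightarrow> nat \<Rightarrow> 'a \<Rightarrow> nat set" where
  "heavy_times X k n \<omega> = {j. j \<le> n \<and> local_time X (walk X j \<omega>) \<omega> \<ge> ereal (k n)}"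

text \<open>
  The supremum of the radii of completely covered balls around the position at time \<open>j\<close>. It is
  extended-real valued: \<open>\<infinity>\<close> if the whole lattice is covered, and \<open>-\<infinity>\<close> if not even the centre is.
\<close>

definition covered_radius ::
    "(nat \<Rightarrow> 'a \<Rightarrow> int ^ 'd) \<Rightarrow> (int ^ 'd) pmf \<Rightarrow> nat \<Rightarrow> 'a \<Rightarrow> ereal" where
  "covered_radius X p j \<omega> =
     Sup (ereal ` {r. r \<ge> 0 \<and> (\<forall>x \<in> lattice_ball p r. local_time X (walk X j \<omega> + x) \<omega> > 0)})"

end

theory Submission
  imports Defs "HOL-Real_Asymp.Real_Asymp"
begin

text \<open>
  Write \<open>d\<close> for the dimension, \<open>\<gamma>\<close> for the escape probability and \<open>S\<close> for the walk. Consider the site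
  \<open>S j\<close> visited at time \<open>j\<close> and a displacement \<open>z \<noteq> 0\<close>. The walk after time \<open>j\<close> and the
  time-reversed walk before time \<open>j\<close>, both seen from \<open>S j\<close>, are independent. If the site has
  \<open>m + 1\<close> visits and \<open>S j + z\<close> has none, then these two walks together make \<open>m\<close> returns to their
  starting point, and none of the excursions meets \<open>z\<close> (or \<open>- z\<close> for the reversed walk). With \<open>q\<close> a
  common bound for the probability of returning before meeting \<open>z\<close> and that of returning before
  meeting \<open>- z\<close>, this has probability at most \<open>(m + 1) * q ^ m\<close> (\<open>prob_path_uncovered_favourite_le\<close>).

  A walk that meets \<open>z\<close> and comes back afterwards returns to the origin, but not in the way counted by
  \<open>q\<close>. Hence \<open>q\<close> is smaller than \<open>1 - \<gamma>\<close> by at least \<open>\<gamma>\<close> times the product of the probabilities of the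
  journeys to \<open>z\<close> and back (\<open>hit_prob_avoiding_le\<close>). Each of these is at least a constant times
  \<open>|z|\<close> to the power \<open>2 - d\<close>, as a hitting probability is the Green function divided by its bounded
  value on the diagonal. So \<open>q\<close> is at most \<open>1 - \<gamma>\<close> times the exponential of \<open>- \<kappa>\<close> times \<open>|z|\<close> to
  the power \<open>4 - 2 d\<close> (\<open>return_avoiding_le\<close>).

  Take \<open>m\<close> close to \<open>k n = (1 - \<delta> n) * \<lambda> * log n\<close>, where \<open>\<lambda> = - 1 / log (1 - \<gamma>)\<close>, and \<open>\<epsilon> \<le> 1\<close>. Then
  \<open>(1 - \<gamma>) ^ m\<close> is about \<open>exp (\<delta> n * log n) / n\<close>. For \<open>|z|\<close> of order \<open>(log n) powr ((1 - \<epsilon>) / (2 d - 4))\<close> the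
  second factor contributes \<open>exp (- \<kappa>' * (log n) powr \<epsilon>)\<close>, and by assumption \<open>\<delta> n * log n\<close> is of smaller
  order than \<open>(log n) powr \<epsilon>\<close>. Summing over the \<open>n + 1\<close> times and the polynomially many (in \<open>log n\<close>)
  displacements leaves a stretched exponential in \<open>log n\<close>. Along \<open>n = 2 ^ l\<close> these bounds are summable,
  the Borel--Cantelli lemma applies, and monotonicity fills the gaps between the powers of two
  (\<open>covered_radius_lower_bound\<close>).

  The bounds for the Green function come from Fourier inversion on the torus. Aperiodicity and the
  second moment give upper and lower quadratic bounds for \<open>1 - char_fun p \<theta>\<close> (\<open>char_fun_le\<close>,
  \<open>char_fun_ge\<close>). The upper bound for the characteristic function makes the Green function
  finite for \<open>d \<ge> 3\<close> (\<open>green_bounded\<close>), which is the transience of the walk. Together the two bounds show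
  that the lazy version of the walk is at a point \<open>y\<close> at time \<open>m\<close> with probability at least
  a constant times \<open>m\<close> to the power \<open>- d / 2\<close>, as soon as \<open>m\<close> exceeds a multiple of \<open>|y|\<^sup>2\<close>
  (\<open>lazy_integral_lower\<close>); summing over a window of times of length comparable to \<open>|y|\<^sup>2\<close> gives the lower bound
  (\<open>green_lower\<close>).
\<close>

section \<open>Hitting probabilities on an abelian group\<close>

text \<open>
  The walk starts at \<open>y\<close> and has horizon \<open>n\<close>; it has to enter \<open>T\<close> before \<open>F\<close>. The
  starting position itself counts neither as a visit to \<open>T\<close> nor as one to \<open>F\<close>, so for
  \<open>y \<in> T\<close> this is a return probability. The recursion conditions on the first step; arguments that
  use the strong Markov property at a hitting time become inductions on the horizon.
\<close>

primrec hit_prob :: "'v::ab_group_add pmf \<Rightarrow> 'v set \<Rightarrow> 'v set \<Rightarrow> nat \<Rightarrow> 'v \<Rightarrow> real" where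
  "hit_prob p T F 0 y = 0"
| "hit_prob p T F (Suc n) y = measure_pmf.expectation p
     (\<lambda>x. if y + x \<in> T then 1 else if y + x \<in> F then 0 else hit_prob p T F n (y + x))"

text \<open>
  The transition probability from \<open>y\<close> to \<open>z\<close> in \<open>n\<close> steps; its sum over \<open>n\<close> is the Green function.
\<close>

primrec step_prob :: "'v::ab_group_add pmf \<Rightarrow> 'v \<Rightarrow> nat \<Rightarrow> 'v \<Rightarrow> real" where
  "step_prob p z 0 y = of_bool (y = z)"
| "step_prob p z (Suc n) y = measure_pmf.expectation p (\<lambda>x. step_prob p z n (y + x))"

lemma integrable_pmf_bounded:
  fixes f :: "'b \<Rightarrow> real"
  assumes "\<And>x. 0 \<le> f x" "\<And>x. f x \<le> B"
  shows "integrable (measure_pmf p) f"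
  using assms by (intro measure_pmf.integrable_const_bound[where B = B]) auto

lemma expectation_unit_interval:
  fixes f :: "'b \<Rightarrow> real"
  assumes "\<And>x. 0 \<le> f x \<and> f x \<le> 1"
  shows "0 \<le> measure_pmf.expectation p f \<and> measure_pmf.expectation p f \<le> 1"
proof
  show "0 \<le> measure_pmf.expectation p f"
    using assms by (intro integral_nonneg_AE) auto
  have "measure_pmf.expectation p f \<le> measure_pmf.expectation p (\<lambda>_. 1)"
    using assms by (intro integral_mono integrable_pmf_bounded[where B = 1]) auto
  then show "measure_pmf.expectation p f \<le> 1" by simp
qed

lemma hit_prob_bounds: "0 \<le> hit_prob p T F n y \<and> hit_prob p T F n y \<le> 1"
proof (induction n arbitrary: y)
  case (Suc n)
  show ?case unfolding hit_prob.simps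
    using Suc by (intro expectation_unit_interval) auto
qed simp

lemmas hit_prob_nonneg = hit_prob_bounds[THEN conjunct1]
  and hit_prob_le_1 = hit_prob_bounds[THEN conjunct2]

lemma step_prob_bounds: "0 \<le> step_prob p z n y \<and> step_prob p z n y \<le> 1"
proof (induction n arbitrary: y)
  case (Suc n)
  show ?case unfolding step_prob.simps
    using Suc by (intro expectation_unit_interval) auto
qed simp

lemmas step_prob_nonneg = step_prob_bounds[THEN conjunct1]
  and step_prob_le_1 = step_prob_bounds[THEN conjunct2]

lemma integrable_hit_step:
  "integrable (measure_pmf p)
     (\<lambda>x. if y + x \<in> T then 1 else if y + x \<in> F then 0 else hit_prob p T F n (y + x))"
  by (intro integrable_pmf_bounded[where B = 1]) (auto simp: hit_prob_nonneg hit_prob_le_1)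

lemma integrable_step_prob: "integrable (measure_pmf p) (\<lambda>x. step_prob p z n (y + x))"
  by (intro integrable_pmf_bounded[where B = 1]) (auto simp: step_prob_nonneg step_prob_le_1)

lemma hit_prob_Suc_mono: "hit_prob p T F n y \<le> hit_prob p T F (Suc n) y"
proof (induction n arbitrary: y)
  case 0
  show ?case using hit_prob_nonneg[of p T F "Suc 0"] by (simp del: hit_prob.simps(2))
next
  case (Suc n)
  show ?case
    unfolding hit_prob.simps(2)[of p T F n y] hit_prob.simps(2)[of p T F "Suc n" y]
    by (intro integral_mono integrable_hit_step) (use Suc in auto)
qed

lemma hit_prob_mono: "m \<le> n \<Longrightarrow> hit_prob p T F m y \<le> hit_prob p T F n y"
  by (rule lift_Suc_mono_le[of "\<lambda>n. hit_prob p T F n y"]) (rule hit_prob_Suc_mono)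

lemma hit_prob_antimono_forbidden: "hit_prob p T F n y \<le> hit_prob p T {} n y"
proof (induction n arbitrary: y)
  case (Suc n)
  show ?case unfolding hit_prob.simps
    by (intro integral_mono integrable_hit_step integrable_hit_step[where F = "{}", simplified])
      (use Suc in \<open>auto simp: hit_prob_nonneg\<close>)
qed simp

text \<open>
  A walk that reaches \<open>z\<close> either does so before visiting \<open>w\<close>, or visits \<open>w\<close> first and then starts
  afresh from there.
\<close>

lemma hit_prob_le_via:
  assumes "n \<le> K" "w \<noteq> z"
  shows "hit_prob p {z} {} n y
           \<le> hit_prob p {z} {w} n y + hit_prob p {w} {z} n y * hit_prob p {z} {} K w"
  using assms(1)
proof (induction n arbitrary: y)
  case (Suc n)
  let ?K = "hit_prob p {z} {} K w"
  let ?a = "\<lambda>x. if y + x \<in> {z} then 1 else if y + x \<in> {w} then 0 else hit_prob p {z} {w} n (y + x)"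
  let ?b = "\<lambda>x. if y + x \<in> {w} then 1 else if y + x \<in> {z} then 0 else hit_prob p {w} {z} n (y + x)"
  have "hit_prob p {z} {} (Suc n) y \<le> measure_pmf.expectation p (\<lambda>x. ?a x + ?b x * ?K)"
    unfolding hit_prob.simps
  proof (rule integral_mono)
    fix x
    have "hit_prob p {z} {} n w \<le> ?K" using Suc.prems by (intro hit_prob_mono) auto
    then show "(if y + x \<in> {z} then 1 else if y + x \<in> {} then 0 else hit_prob p {z} {} n (y + x))
                \<le> ?a x + ?b x * ?K"
      using Suc.IH[of "y + x"] Suc.prems assms(2) by auto
  qed (intro integrable_hit_step Bochner_Integration.integrable_add integrable_mult_left)+
  also have "\<dots> = measure_pmf.expectation p ?a + measure_pmf.expectation p ?b * ?K"
    by (subst Bochner_Integration.integral_add)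
       (intro integrable_hit_step integrable_mult_left | simp)+
  finally show ?case by simp
qed simp

text \<open>
  The walk can reach \<open>w\<close> directly, or through \<open>z\<close>; the two ways exclude each other. The horizons
  add up because the second way needs time for both journeys.
\<close>

lemma hit_prob_ge_split:
  assumes "w \<noteq> z"
  shows "hit_prob p {w} {z} n y + hit_prob p {z} {w} n y * hit_prob p {w} {} K z
           \<le> hit_prob p {w} {} (n + K) y"
proof (induction n arbitrary: y)
  case 0
  show ?case by (simp add: hit_prob_nonneg)
next
  case (Suc n)
  let ?K = "hit_prob p {w} {} K z"
  let ?a = "\<lambda>x. if y + x \<in> {z} then 1 else if y + x \<in> {w} then 0 else hit_prob p {z} {w} n (y + x)"
  let ?b = "\<lambda>x. if y + x \<in> {w} then 1 else if y + x \<in> {z} then 0 else hit_prob p {w} {z} n (y + x)"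
  have "measure_pmf.expectation p ?b + measure_pmf.expectation p ?a * ?K
          = measure_pmf.expectation p (\<lambda>x. ?b x + ?a x * ?K)"
    by (subst Bochner_Integration.integral_add)
       (intro integrable_hit_step integrable_mult_left | simp)+
  also have "\<dots> \<le> hit_prob p {w} {} (Suc (n + K)) y"
    unfolding hit_prob.simps
  proof (rule integral_mono)
    fix x
    have "?K \<le> hit_prob p {w} {} (n + K) z" by (intro hit_prob_mono) auto
    then show "?b x + ?a x * ?K \<le>
      (if y + x \<in> {w} then 1 else if y + x \<in> {} then 0 else hit_prob p {w} {} (n + K) (y + x))"
      using Suc.IH[of "y + x"] assms by auto
  qed (intro integrable_hit_step Bochner_Integration.integrable_add integrable_mult_left)+
  finally show ?case by simp
qed

text \<open>
  The expected number of visits to \<open>z\<close> up to time \<open>n\<close> is at most the probability of a first visit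
  times the expected number of visits counted from there. This turns lower bounds for the Green
  function into lower bounds for hitting probabilities.
\<close>

lemma step_prob_sum_le_hit_prob:
  assumes "n \<le> N"
  shows "(\<Sum>i=1..n. step_prob p z i y) \<le> hit_prob p {z} {} n y * (\<Sum>i\<le>N. step_prob p z i z)"
  using assms
proof (induction n arbitrary: y)
  case (Suc n)
  let ?G = "\<Sum>i\<le>N. step_prob p z i z"
  let ?h = "\<lambda>x. if y + x \<in> {z} then 1 else if y + x \<in> {} then 0 else hit_prob p {z} {} n (y + x)"
  have shift: "(\<Sum>i=1..Suc n. step_prob p z i y) = (\<Sum>i\<le>n. step_prob p z (Suc i) y)"
    by (simp only: One_nat_def sum.shift_bounds_cl_Suc_ivl atLeast0AtMost[symmetric])
  also have "\<dots> = measure_pmf.expectation p (\<lambda>x. \<Sum>i\<le>n. step_prob p z i (y + x))"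
    by (simp add: Bochner_Integration.integral_sum integrable_step_prob)
  also have "\<dots> \<le> measure_pmf.expectation p (\<lambda>x. ?h x * ?G)"
  proof (rule integral_mono)
    fix x
    have split: "(\<Sum>i\<le>n. step_prob p z i v) = step_prob p z 0 v + (\<Sum>i=1..n. step_prob p z i v)" for v
      by (simp add: atLeast0AtMost[symmetric] sum.atLeast_Suc_atMost)
    show "(\<Sum>i\<le>n. step_prob p z i (y + x)) \<le> ?h x * ?G"
    proof (cases "y + x = z")
      case True
      then show ?thesis using Suc.prems by (auto intro!: sum_mono2 simp: step_prob_nonneg)
    next
      case False
      then show ?thesis unfolding split using Suc by simp
    qed
  qed (intro integrable_hit_step Bochner_Integration.integrable_sum integrable_step_prob
         integrable_mult_left)+
  also have "\<dots> = measure_pmf.expectation p ?h * ?G" by simp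
  finally show ?case by simp
qed simp

text \<open>
  The same decomposition at the first visit, estimated from below: after a first visit within time
  \<open>n\<close>, another \<open>K\<close> steps are available.
\<close>

lemma step_prob_sum_ge_hit_prob:
  "hit_prob p {z} {} n y * (\<Sum>i\<le>K. step_prob p z i z) \<le> (\<Sum>i=1..n+K. step_prob p z i y)"
proof (induction n arbitrary: y)
  case 0
  show ?case by (simp add: sum_nonneg step_prob_nonneg)
next
  case (Suc n)
  let ?G = "\<Sum>i\<le>K. step_prob p z i z"
  let ?h = "\<lambda>x. if y + x \<in> {z} then 1 else if y + x \<in> {} then 0 else hit_prob p {z} {} n (y + x)"
  have "hit_prob p {z} {} (Suc n) y * ?G = measure_pmf.expectation p (\<lambda>x. ?h x * ?G)" by simp
  also have "\<dots> \<le> measure_pmf.expectation p (\<lambda>x. \<Sum>i\<le>n+K. step_prob p z i (y + x))"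
  proof (rule integral_mono)
    fix x
    have split: "(\<Sum>i\<le>n+K. step_prob p z i v) = step_prob p z 0 v + (\<Sum>i=1..n+K. step_prob p z i v)" for v
      by (simp add: atLeast0AtMost[symmetric] sum.atLeast_Suc_atMost)
    show "?h x * ?G \<le> (\<Sum>i\<le>n+K. step_prob p z i (y + x))"
    proof (cases "y + x = z")
      case True
      then show ?thesis by (auto intro!: sum_mono2 simp: step_prob_nonneg)
    next
      case False
      then show ?thesis unfolding split using Suc by simp
    qed
  qed (intro integrable_hit_step Bochner_Integration.integrable_sum integrable_step_prob
         integrable_mult_left)+
  also have "\<dots> = (\<Sum>i\<le>n+K. step_prob p z (Suc i) y)"
    by (simp add: Bochner_Integration.integral_sum integrable_step_prob)
  also have "\<dots> = (\<Sum>i=1..Suc n+K. step_prob p z i y)"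
    by (simp only: One_nat_def sum.shift_bounds_cl_Suc_ivl atLeast0AtMost[symmetric] add_Suc)
  finally show ?case .
qed

text \<open>
  Let \<open>L \<le> G\<close> be the value of the Green function on the diagonal. Decomposing at the first return
  gives \<open>h * L \<le> L - 1\<close> for the return probability \<open>h\<close>. Thus a finite Green function
  makes the walk transient, with an explicit bound.
\<close>

lemma hit_prob_return_le:
  assumes G: "\<And>N. (\<Sum>n\<le>N. step_prob p z n z) \<le> G"
  shows "hit_prob p {z} {} n z \<le> 1 - 1 / G"
proof -
  define S where "S = (\<lambda>N. \<Sum>n\<le>N. step_prob p z n z)"
  have inc: "incseq S" unfolding S_def by (intro incseq_SucI) (simp add: step_prob_nonneg)
  obtain L where L: "S \<longlonglongrightarrow> L" "\<And>N. S N \<le> L"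
    using incseq_convergent[OF inc, of G] G unfolding S_def by blast
  have split: "S N = 1 + (\<Sum>i=1..N. step_prob p z i z)" for N
    unfolding S_def by (simp add: atLeast0AtMost[symmetric] sum.atLeast_Suc_atMost)
  have "hit_prob p {z} {} n z * S K \<le> L - 1" for K
    using step_prob_sum_ge_hit_prob[of p z n z K] L(2)[of "n + K"] split[of "n + K"] by (simp add: S_def)
  then have "hit_prob p {z} {} n z * L \<le> L - 1"
    by (intro LIMSEQ_le_const2[OF tendsto_mult_left[OF L(1)]]) auto
  moreover have "L \<ge> 1" using L(2)[of 0] by (simp add: S_def)
  ultimately have "hit_prob p {z} {} n z \<le> 1 - 1 / L" by (simp add: field_simps)
  also have "\<dots> \<le> 1 - 1 / G"
  proof -
    have "L \<le> G" by (rule LIMSEQ_le_const2[OF L(1)]) (use G in \<open>auto simp: S_def\<close>)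
    then show ?thesis using \<open>L \<ge> 1\<close> by (simp add: frac_le)
  qed
  finally show ?thesis .
qed

text \<open>
  With \<open>h\<close> the probability of returning to \<open>w\<close> before visiting \<open>z\<close>, and \<open>b'\<close> that of visiting \<open>z\<close>
  before returning to \<open>w\<close>, the two decompositions above read \<open>a \<le> b' + h * a\<close> and
  \<open>h + b' * b \<le> 1 - g\<close>. Since \<open>1 - h \<ge> g\<close>, the first gives \<open>b' \<ge> g * a\<close>. So every unit of probability for the
  round trip from \<open>w\<close> to \<open>z\<close> and back is lost, up to the factor \<open>g\<close>, for the returns that
  avoid \<open>z\<close>.
\<close>

lemma hit_prob_avoiding_le:
  assumes "w \<noteq> z"
    and esc: "\<And>n. hit_prob p {w} {} n w \<le> 1 - g" and "g \<ge> 0"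
    and a: "a \<le> hit_prob p {z} {} N w" "0 \<le> a"
    and b: "b \<le> hit_prob p {w} {} K z" "0 \<le> b"
  shows "hit_prob p {w} {z} n w \<le> 1 - g - g * a * b"
proof -
  define m where "m = max n N"
  let ?h = "hit_prob p {w} {z} m w" and ?b = "hit_prob p {z} {w} m w"
  have w: "a \<le> hit_prob p {z} {} m w"
    using a(1) hit_prob_mono[of N m p "{z}" "{}" w] by (simp add: m_def)
  have "hit_prob p {z} {} m w \<le> ?b + ?h * hit_prob p {z} {} m w"
    by (rule hit_prob_le_via) (use assms in auto)
  moreover have "?h \<le> 1 - g"
    using hit_prob_antimono_forbidden esc order_trans by blast
  ultimately have "g * a \<le> ?b"
  proof -
    assume 1: "hit_prob p {z} {} m w \<le> ?b + ?h * hit_prob p {z} {} m w" and 2: "?h \<le> 1 - g"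
    have "g * a \<le> (1 - ?h) * hit_prob p {z} {} m w"
      using 2 w a(2) \<open>g \<ge> 0\<close> by (intro mult_mono) auto
    then show ?thesis using 1 by (simp add: algebra_simps)
  qed
  then have "g * a * b \<le> ?b * hit_prob p {w} {} K z"
    using a b \<open>g \<ge> 0\<close> by (intro mult_mono) (auto simp: hit_prob_nonneg)
  moreover have "?h + ?b * hit_prob p {w} {} K z \<le> 1 - g"
    using hit_prob_ge_split[OF \<open>w \<noteq> z\<close>] esc order_trans by blast
  moreover have "hit_prob p {w} {z} n w \<le> ?h" by (intro hit_prob_mono) (simp add: m_def)
  ultimately show ?thesis by linarith
qed

section \<open>Fourier inversion on the torus\<close>

definition circle :: "real measure" where
  "circle = uniform_measure lborel {-pi..pi}"

text \<open>
  The dual group of the lattice, with normalised Haar measure: every angle is uniform on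
  \<open>[-\<pi>, \<pi>]\<close>. Angles are kept as functions on the index type, so that integrals of
  products of functions of single coordinates factorise.
\<close>

definition torus :: "('d::finite \<Rightarrow> real) measure" where
  "torus = Pi\<^sub>M UNIV (\<lambda>_. circle)"

definition dot :: "('d::finite \<Rightarrow> real) \<Rightarrow> int ^ 'd \<Rightarrow> real" where
  "dot \<theta> x = (\<Sum>i\<in>UNIV. \<theta> i * real_of_int (x $ i))"

lemma prob_space_circle: "prob_space circle"
  unfolding circle_def by (intro prob_space_uniform_measure) auto

interpretation circle: prob_space circle by (rule prob_space_circle)

interpretation circles: product_prob_space "\<lambda>_::'d::finite. circle" UNIV
  by unfold_locales

interpretation torus: prob_space torus
  unfolding torus_def by (rule prob_space_PiM) (rule prob_space_circle)

lemma space_circle [simp]: "space circle = UNIV" and sets_circle [measurable_cong]: "sets circle = sets borel"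
  by (simp_all add: circle_def)

lemma space_torus [simp]: "space torus = UNIV"
  by (simp add: torus_def space_PiM)

lemma circle_density: "circle = density lborel (\<lambda>x. ennreal (indicator {-pi..pi} x / (2 * pi)))"
  unfolding circle_def uniform_measure_def
  by (intro density_cong) (auto simp: indicator_def divide_ennreal[symmetric] ennreal_mult'[symmetric])

lemma integrable_circleI:
  fixes f :: "real \<Rightarrow> 'b::{banach, second_countable_topology}"
  assumes [measurable]: "f \<in> borel_measurable borel"
    and "integrable lborel (\<lambda>x. indicator {-pi..pi} x *\<^sub>R f x)"
  shows "integrable circle f"
proof -
  have "integrable lborel (\<lambda>x. (1 / (2 * pi)) *\<^sub>R (indicator {-pi..pi} x *\<^sub>R f x))"
    by (intro integrable_scaleR_right assms(2))
  then show ?thesis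
    unfolding circle_density by (subst integrable_density) (auto simp: field_simps)
qed

lemma integral_circle:
  fixes f :: "real \<Rightarrow> 'b::{banach, second_countable_topology}"
  assumes [measurable]: "f \<in> borel_measurable borel"
  shows "integral\<^sup>L circle f = (1 / (2 * pi)) *\<^sub>R (\<integral>x. indicator {-pi..pi} x *\<^sub>R f x \<partial>lborel)"
proof -
  have "integral\<^sup>L circle f = (\<integral>x. (1 / (2 * pi)) *\<^sub>R (indicator {-pi..pi} x *\<^sub>R f x) \<partial>lborel)"
    unfolding circle_density by (subst integral_density) (auto simp: field_simps)
  then show ?thesis by (simp only: integral_scaleR_right)
qed

lemma integrable_circle_bounded:
  fixes f :: "real \<Rightarrow> 'b::{banach, second_countable_topology}"
  assumes "f \<in> borel_measurable borel" "\<And>x. norm (f x) \<le> B"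
  shows "integrable circle f"
  using assms by (intro circle.integrable_const_bound[where B = B]) (auto simp: measurable_cong_sets[OF sets_circle refl])

lemma torus_integral_prod:
  fixes f :: "'d::finite \<Rightarrow> real \<Rightarrow> 'b::{real_normed_field, banach, second_countable_topology}"
  assumes "\<And>i. integrable circle (f i)"
  shows "(\<integral>\<theta>. (\<Prod>i\<in>UNIV. f i (\<theta> i)) \<partial>torus) = (\<Prod>i\<in>UNIV. integral\<^sup>L circle (f i))"
    and "integrable torus (\<lambda>\<theta>. \<Prod>i\<in>UNIV. f i (\<theta> i))"
  unfolding torus_def
  using circles.product_integral_prod[of UNIV f] circles.product_integrable_prod[of UNIV f] assms
  by auto

lemma AE_torus_component:
  assumes "AE x in circle. P x"
  shows "AE \<theta> in torus. \<forall>i::'d::finite. P (\<theta> i)"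
proof -
  have "AE \<theta> in torus. P (\<theta> i)" for i :: 'd
    unfolding torus_def by (rule AE_PiM_component) (use assms prob_space_circle in auto)
  then have "AE \<theta> in torus. \<forall>i\<in>(UNIV::'d set). P (\<theta> i)"
    by (intro AE_finite_allI) auto
  then show ?thesis by simp
qed

lemma AE_torus_box: "AE \<theta> in torus. \<forall>i::'d::finite. \<bar>\<theta> i\<bar> \<le> pi"
proof (rule AE_torus_component)
  show "AE x in circle. \<bar>x\<bar> \<le> pi"
    unfolding circle_def by (rule AE_uniform_measureI) auto
qed

lemma AE_torus_nonzero: "AE \<theta> in torus. \<forall>i::'d::finite. \<theta> i \<noteq> 0"
proof (rule AE_torus_component)
  show "AE x in circle. x \<noteq> 0"
    unfolding circle_def
    by (intro AE_uniform_measureI eventually_mono[OF AE_lborel_singleton[of 0]]) auto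
qed

lemma measurable_torus_component: "(\<lambda>\<theta>. \<theta> (i::'d::finite)) \<in> borel_measurable torus"
proof -
  have "(\<lambda>\<theta>. \<theta> i) \<in> measurable torus circle"
    unfolding torus_def by measurable
  then show ?thesis by (simp add: measurable_cong_sets[OF refl sets_circle])
qed

lemma measurable_dot [measurable]: "(\<lambda>\<theta>. dot \<theta> x) \<in> borel_measurable torus"
  unfolding dot_def using measurable_torus_component by measurable

lemma circle_exp_integral: "(\<integral>t. exp (\<i> * of_int k * of_real t) \<partial>circle) = of_bool (k = 0)"
proof (cases "k = 0")
  case True
  then show ?thesis using circle.prob_space by simp
next
  case False
  let ?f = "\<lambda>t. exp (\<i> * of_int k * complex_of_real t)"
  let ?F = "\<lambda>t. ?f t / (\<i> * of_int k)"
  have "(\<integral>x. indicator {-pi..pi} x *\<^sub>R ?f x \<partial>lborel) = ?F pi - ?F (-pi)"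
  proof (intro has_bochner_integral_integral_eq has_bochner_integral_FTC_Icc)
    fix x
    show "(?F has_vector_derivative ?f x) (at x within {- pi..pi})"
      using False by (auto intro!: derivative_eq_intros has_vector_derivative_real_field)
  qed (auto intro!: continuous_intros)
  also have "?f pi = ?f (-pi)"
  proof -
    have "?f pi = ?f (-pi) * exp (2 * of_int k * pi * \<i>)"
      by (subst exp_add[symmetric]) (simp add: algebra_simps)
    also have "exp (2 * of_int k * pi * \<i>) = 1" by (rule exp_integer_2pi) simp
    finally show ?thesis by simp
  qed
  finally show ?thesis using False by (subst integral_circle) auto
qed

lemma torus_cos_integral: "(\<integral>\<theta>. cos (dot \<theta> x) \<partial>torus) = of_bool (x = 0)"
proof -
  let ?f = "\<lambda>i t. exp (\<i> * of_int (x $ i) * complex_of_real t)"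
  have int: "integrable circle (?f i)" for i
    by (rule integrable_circle_bounded[where B = 1]) (auto simp: norm_exp_eq_Re)
  have eq: "exp (\<i> * of_real (dot \<theta> x)) = (\<Prod>i\<in>UNIV. ?f i (\<theta> i))" for \<theta>
    by (simp add: dot_def exp_sum[symmetric] sum_distrib_left mult_ac)
  have "integrable torus (\<lambda>\<theta>. exp (\<i> * of_real (dot \<theta> x)))"
    unfolding eq by (rule torus_integral_prod(2)) (rule int)
  then have "(\<integral>\<theta>. Re (exp (\<i> * of_real (dot \<theta> x))) \<partial>torus)
      = Re (\<integral>\<theta>. exp (\<i> * of_real (dot \<theta> x)) \<partial>torus)"
    by (rule integral_Re)
  also have "(\<integral>\<theta>. exp (\<i> * of_real (dot \<theta> x)) \<partial>torus) = (\<Prod>i\<in>UNIV. of_bool (x $ i = 0))"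
    unfolding eq by (subst torus_integral_prod(1)) (auto simp: int circle_exp_integral)
  also have "\<dots> = of_bool (x = 0)"
    by (auto simp: vec_eq_iff of_bool_def)
  finally show ?thesis by (simp add: Re_exp)
qed

text \<open>
  For a symmetric law this is the characteristic function, which is then real.
\<close>

definition char_fun :: "(int ^ 'd) pmf \<Rightarrow> ('d::finite \<Rightarrow> real) \<Rightarrow> real" where
  "char_fun p \<theta> = measure_pmf.expectation p (\<lambda>x. cos (dot \<theta> x))"

lemma integrable_pmf_cos: "integrable (measure_pmf p) (\<lambda>x. cos (dot \<theta> (f x)))"
  and integrable_pmf_sin: "integrable (measure_pmf p) (\<lambda>x. sin (dot \<theta> (f x)))"
  by (intro measure_pmf.integrable_const_bound[where B = 1]; simp)+

text \<open>
  The lattice is countable, so measurability in the angle for every fixed lattice point is joint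
  measurability; this is what the uses of Fubini's theorem below require.
\<close>

lemma measurable_pmf_torus:
  fixes f :: "int ^ 'd \<Rightarrow> ('d \<Rightarrow> real) \<Rightarrow> real"
  assumes "\<And>x. f x \<in> borel_measurable torus"
  shows "case_prod f \<in> borel_measurable (measure_pmf p \<Otimes>\<^sub>M torus)"
proof -
  have "case_prod f \<in> borel_measurable (count_space UNIV \<Otimes>\<^sub>M torus)"
    by (rule measurable_pair_measure_countable1) (use assms in auto)
  also have "borel_measurable (count_space UNIV \<Otimes>\<^sub>M torus) = borel_measurable (measure_pmf p \<Otimes>\<^sub>M torus)"
    by (intro measurable_cong_sets sets_pair_measure_cong) auto
  finally show ?thesis .
qed

lemma measurable_char_fun [measurable]: "char_fun p \<in> borel_measurable torus"
proof -
  interpret pair_sigma_finite "measure_pmf p" torus ..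
  have "(\<lambda>(\<theta>, x). cos (dot \<theta> x)) \<in> borel_measurable (torus \<Otimes>\<^sub>M measure_pmf p)"
    by (subst measurable_pair_swap_iff)
       (use measurable_pmf_torus[of "\<lambda>x \<theta>. cos (dot \<theta> x)" p] in \<open>simp add: case_prod_beta\<close>)
  then show ?thesis
    unfolding char_fun_def[abs_def]
    by (intro measure_pmf.borel_measurable_lebesgue_integral) simp
qed

lemma char_fun_bounds: "\<bar>char_fun p \<theta>\<bar> \<le> 1"
proof -
  have "\<bar>char_fun p \<theta>\<bar> \<le> measure_pmf.expectation p (\<lambda>x. \<bar>cos (dot \<theta> x)\<bar>)"
    unfolding char_fun_def by (rule integral_abs_bound)
  also have "\<dots> \<le> measure_pmf.expectation p (\<lambda>x. 1)"
    by (intro integral_mono integrable_abs integrable_pmf_cos) auto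
  finally show ?thesis by simp
qed

lemma pmf_expectation_uminus:
  assumes "symmetric_law p"
  shows "measure_pmf.expectation p (\<lambda>x. f (- x)) = measure_pmf.expectation p (f :: _ \<Rightarrow> real)"
proof -
  have "map_pmf uminus p = p"
  proof (rule pmf_eqI)
    fix x
    have "pmf (map_pmf uminus p) (- (- x)) = pmf p (- x)"
      by (subst pmf_map_inj') auto
    then show "pmf (map_pmf uminus p) x = pmf p x"
      using assms unfolding symmetric_law_def by simp
  qed
  then have "measure_pmf.expectation p f = measure_pmf.expectation (map_pmf uminus p) f" by simp
  then show ?thesis by simp
qed

lemma dot_add: "dot \<theta> (x + y) = dot \<theta> x + dot \<theta> y"
  and dot_uminus: "dot \<theta> (- x) = - dot \<theta> x"
  and dot_zero [simp]: "dot \<theta> 0 = 0"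
  by (simp_all add: dot_def algebra_simps sum.distrib sum_negf)

lemma expectation_cos_shift:
  assumes "symmetric_law p"
  shows "measure_pmf.expectation p (\<lambda>x. cos (dot \<theta> (y + x))) = cos (dot \<theta> y) * char_fun p \<theta>"
proof -
  have "measure_pmf.expectation p (\<lambda>x. sin (dot \<theta> x)) = 0"
    using pmf_expectation_uminus[OF assms, of "\<lambda>x. sin (dot \<theta> x)"] by (simp add: dot_uminus)
  then show ?thesis
    unfolding char_fun_def dot_add cos_add
    by (subst Bochner_Integration.integral_diff)
       (auto intro!: integrable_mult_right integrable_pmf_cos integrable_pmf_sin)
qed

text \<open>
  Fourier inversion, by induction on \<open>n\<close>: the case \<open>n = 0\<close> is the orthogonality of characters, and
  one more step of the walk multiplies the integrand by the characteristic function because the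
  sine part of the addition theorem vanishes by symmetry.
\<close>

lemma step_prob_fourier:
  assumes "symmetric_law p"
  shows "step_prob p z n y = (\<integral>\<theta>. char_fun p \<theta> ^ n * cos (dot \<theta> (y - z)) \<partial>torus)"
proof (induction n arbitrary: y)
  case 0
  show ?case using torus_cos_integral[of "y - z"] by simp
next
  case (Suc n)
  interpret pair_sigma_finite "measure_pmf p" torus ..
  interpret pair_prob_space "measure_pmf p" torus ..
  have "step_prob p z (Suc n) y
     = measure_pmf.expectation p (\<lambda>x. \<integral>\<theta>. char_fun p \<theta> ^ n * cos (dot \<theta> ((y - z) + x)) \<partial>torus)"
    by (simp add: Suc algebra_simps)
  also have "\<dots> = (\<integral>\<theta>. measure_pmf.expectation p (\<lambda>x. char_fun p \<theta> ^ n * cos (dot \<theta> ((y - z) + x))) \<partial>torus)"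
  proof (rule Fubini_integral[symmetric])
    show "integrable (measure_pmf p \<Otimes>\<^sub>M torus)
       (\<lambda>(x, \<theta>). char_fun p \<theta> ^ n * cos (dot \<theta> (y - z + x)))"
    proof (rule P.integrable_const_bound[where B = 1])
      show "AE x in measure_pmf p \<Otimes>\<^sub>M torus.
          norm (case x of (x, \<theta>) \<Rightarrow> char_fun p \<theta> ^ n * cos (dot \<theta> (y - z + x))) \<le> 1"
        by (auto simp: abs_mult power_abs case_prod_beta intro!: mult_le_one power_le_one char_fun_bounds)
    qed (rule measurable_pmf_torus, measurable)
  qed
  also have "\<dots> = (\<integral>\<theta>. char_fun p \<theta> ^ Suc n * cos (dot \<theta> (y - z)) \<partial>torus)"
    by (simp add: expectation_cos_shift[OF assms] mult_ac)
  finally show ?case .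
qed

section \<open>The characteristic function near its maximum\<close>

text \<open>
  The support of the law generates the whole group, in the form of an induction principle: a
  subgroup that contains the support is everything.
\<close>

definition generates_lattice :: "(int ^ 'd) pmf \<Rightarrow> bool" where
  "generates_lattice p \<longleftrightarrow>
     (\<forall>D. 0 \<in> D \<longrightarrow> set_pmf p \<subseteq> D \<longrightarrow> (\<forall>x\<in>D. \<forall>y\<in>D. x + y \<in> D) \<longrightarrow> (\<forall>x\<in>D. - x \<in> D) \<longrightarrow> D = UNIV)"

text \<open>
  The squared Euclidean length, for angles that are functions.
\<close>

definition sq_len :: "('d::finite \<Rightarrow> real) \<Rightarrow> real" where
  "sq_len \<theta> = (\<Sum>i\<in>UNIV. (\<theta> i)\<^sup>2)"

lemma sq_len_nonneg: "0 \<le> sq_len \<theta>"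
  by (simp add: sq_len_def sum_nonneg)

lemma measurable_sq_len [measurable]: "sq_len \<in> borel_measurable torus"
  unfolding sq_len_def[abs_def] using measurable_torus_component by measurable

text \<open>
  Taylor's formula of order four with \<open>\<pi>\<^sup>2 < 10\<close>: the bracket \<open>1 / 2 - t\<^sup>2 / 24\<close> stays above \<open>1 / 20\<close>
  on the whole period.
\<close>

lemma one_minus_cos_ge:
  fixes t :: real
  assumes "\<bar>t\<bar> \<le> pi"
  shows "t\<^sup>2 / 20 \<le> 1 - cos t"
proof -
  obtain s where s: "cos t = (\<Sum>m<4. cos_coeff m * t ^ m) + (cos (s + 1/2 * real 4 * pi) / fact 4) * t ^ 4"
    using Maclaurin_cos_expansion[of t 4] by blast
  have "(cos (s + 1/2 * real 4 * pi) / fact 4) * t ^ 4 \<le> (1 / 24) * t ^ 4"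
    by (intro mult_right_mono) (auto simp: fact_numeral)
  moreover have "(\<Sum>m<4. cos_coeff m * t ^ m) = 1 - t\<^sup>2 / 2"
  proof -
    have "{..<4::nat} = {0, 1, 2, 3}" by auto
    then show ?thesis by (simp add: cos_coeff_def fact_numeral)
  qed
  moreover have "t ^ 4 \<le> 10 * t\<^sup>2"
  proof -
    have "t\<^sup>2 \<le> pi\<^sup>2" using assms by (metis abs_le_square_iff abs_of_nonneg pi_ge_zero)
    also have "\<dots> \<le> (3.15)\<^sup>2" using pi_approx by (intro power_mono) auto
    also have "\<dots> \<le> 10" by (simp add: power2_eq_square)
    finally have "t\<^sup>2 * t\<^sup>2 \<le> 10 * t\<^sup>2" by (intro mult_right_mono) auto
    then show ?thesis by (simp add: power2_eq_square power4_eq_xxxx mult_ac)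
  qed
  ultimately show ?thesis using s zero_le_power2[of t] by linarith
qed

text \<open>
  Since \<open>1 - cos x = 2 * (sin (x / 2))\<^sup>2\<close>, this is subadditivity of \<open>\<bar>sin\<bar>\<close> followed by
  \<open>(u + v)\<^sup>2 \<le> 2 * u\<^sup>2 + 2 * v\<^sup>2\<close>.
\<close>

lemma one_minus_cos_add_le:
  fixes a b :: real
  shows "1 - cos (a + b) \<le> 2 * (1 - cos a) + 2 * (1 - cos b)"
proof -
  have half: "1 - cos x = 2 * (sin (x / 2))\<^sup>2" for x :: real
    using cos_double_sin[of "x / 2"] by simp
  have "\<bar>sin ((a + b) / 2)\<bar> \<le> \<bar>sin (a / 2)\<bar> + \<bar>sin (b / 2)\<bar>"
  proof -
    have "\<bar>sin (a / 2) * cos (b / 2)\<bar> \<le> \<bar>sin (a / 2)\<bar>" "\<bar>cos (a / 2) * sin (b / 2)\<bar> \<le> \<bar>sin (b / 2)\<bar>"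
      by (auto simp: abs_mult mult_left_le mult_left_le_one_le)
    then show ?thesis by (simp add: add_divide_distrib sin_add)
  qed
  then have "(sin ((a + b) / 2))\<^sup>2 \<le> (\<bar>sin (a / 2)\<bar> + \<bar>sin (b / 2)\<bar>)\<^sup>2"
    by (metis abs_ge_zero abs_of_nonneg abs_le_square_iff add_nonneg_nonneg)
  also have "\<dots> \<le> 2 * (sin (a / 2))\<^sup>2 + 2 * (sin (b / 2))\<^sup>2"
    using sum_squares_bound[of "\<bar>sin (a / 2)\<bar>" "\<bar>sin (b / 2)\<bar>"] by (simp add: power2_sum)
  finally show ?thesis unfolding half by simp
qed

lemma dot_axis: "dot \<theta> (axis i 1) = \<theta> i"
  by (simp add: dot_def axis_def if_distrib cong: if_cong)

text \<open>
  The points \<open>y\<close> for which \<open>1 - cos (dot \<theta> y)\<close> is bounded by a multiple of \<open>1 - char_fun p \<theta>\<close>,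
  uniformly in \<open>\<theta>\<close>, form a subgroup containing the support of \<open>p\<close>. As that support generates the
  lattice, the unit vectors belong to it, and summing their bounds compares the walk with the
  simple random walk. This covers the whole box at once, so it also excludes that the
  characteristic function takes the value 1 there away from zero.
\<close>

lemma char_fun_le:
  assumes "generates_lattice p"
  shows "\<exists>c>0. \<forall>\<theta>. (\<forall>i. \<bar>\<theta> i\<bar> \<le> pi) \<longrightarrow> char_fun p \<theta> \<le> 1 - c * sq_len \<theta>"
proof -
  define D where "D = {y. \<exists>K\<ge>0. \<forall>\<theta>. 1 - cos (dot \<theta> y) \<le> K * (1 - char_fun p \<theta>)}"
  have nonneg: "0 \<le> 1 - char_fun p \<theta>" for \<theta>
    using char_fun_bounds[of p \<theta>] by linarith
  have "D = UNIV"
  proof (rule assms[unfolded generates_lattice_def, rule_format])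
    show "0 \<in> D" by (auto simp: D_def intro!: exI[of _ 0])
    show "set_pmf p \<subseteq> D"
    proof
      fix x assume x: "x \<in> set_pmf p"
      have pos: "pmf p x > 0" using x by (simp add: pmf_positive)
      have "1 - cos (dot \<theta> x) \<le> (1 / pmf p x) * (1 - char_fun p \<theta>)" for \<theta>
      proof -
        \<comment> \<open>The single summand at x of the nonnegative sum that defines the right-hand side.\<close>
        have "pmf p x * (1 - cos (dot \<theta> x))
            = measure_pmf.expectation p (\<lambda>y. indicator {x} y * (1 - cos (dot \<theta> x)))"
          by (simp add: measure_pmf_single)
        also have "\<dots> \<le> measure_pmf.expectation p (\<lambda>y. 1 - cos (dot \<theta> y))"
          by (intro integral_mono integrable_mult_left Bochner_Integration.integrable_diff integrable_pmf_cos)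
             (auto simp: indicator_def intro!: integrable_pmf_bounded[where B = 1])
        also have "\<dots> = 1 - char_fun p \<theta>"
          unfolding char_fun_def by (subst Bochner_Integration.integral_diff) (auto intro: integrable_pmf_cos)
        finally show ?thesis using pos by (simp add: field_simps)
      qed
      then show "x \<in> D" unfolding D_def using pos by (auto intro!: exI[of _ "1 / pmf p x"])
    qed
    show "x + y \<in> D" if xy: "x \<in> D" "y \<in> D" for x y
    proof -
      obtain K L where K: "K \<ge> 0" "\<And>\<theta>. 1 - cos (dot \<theta> x) \<le> K * (1 - char_fun p \<theta>)"
        and L: "L \<ge> 0" "\<And>\<theta>. 1 - cos (dot \<theta> y) \<le> L * (1 - char_fun p \<theta>)"
        using xy unfolding D_def by blast
      have "1 - cos (dot \<theta> (x + y)) \<le> (2 * K + 2 * L) * (1 - char_fun p \<theta>)" for \<theta>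
        using one_minus_cos_add_le[of "dot \<theta> x" "dot \<theta> y"] K(2)[of \<theta>] L(2)[of \<theta>]
        by (simp add: dot_add algebra_simps)
      then show ?thesis unfolding D_def using K(1) L(1) by (auto intro!: exI[of _ "2 * K + 2 * L"])
    qed
    show "- x \<in> D" if "x \<in> D" for x using that by (simp add: D_def dot_uminus)
  qed
  have "\<forall>i. \<exists>K\<ge>0. \<forall>\<theta>. 1 - cos (\<theta> i) \<le> K * (1 - char_fun p \<theta>)"
  proof (intro allI)
    fix i
    have "axis i 1 \<in> D" using \<open>D = UNIV\<close> by simp
    then show "\<exists>K\<ge>0. \<forall>\<theta>. 1 - cos (\<theta> i) \<le> K * (1 - char_fun p \<theta>)"
      by (simp add: D_def dot_axis)
  qed
  then obtain K where K: "\<And>i. K i \<ge> 0" "\<And>i \<theta>. 1 - cos (\<theta> i) \<le> K i * (1 - char_fun p \<theta>)"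
    by metis
  define c where "c = 1 / (20 * (1 + (\<Sum>i\<in>UNIV. K i)))"
  have den: "1 + (\<Sum>i\<in>UNIV. K i) > 0"
    using sum_nonneg[of UNIV K] K(1) by (smt (verit))
  have "char_fun p \<theta> \<le> 1 - c * sq_len \<theta>" if box: "\<forall>i. \<bar>\<theta> i\<bar> \<le> pi" for \<theta>
  proof -
    have "sq_len \<theta> / 20 \<le> (\<Sum>i\<in>UNIV. K i * (1 - char_fun p \<theta>))"
      unfolding sq_len_def sum_divide_distrib
      using K(2) one_minus_cos_ge box order_trans by (intro sum_mono) blast
    also have "\<dots> \<le> (1 + (\<Sum>i\<in>UNIV. K i)) * (1 - char_fun p \<theta>)"
      using nonneg[of \<theta>] by (simp add: sum_distrib_right[symmetric] mult_right_mono)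
    finally show ?thesis unfolding c_def using den by (simp add: field_simps)
  qed
  moreover have "c > 0" unfolding c_def using den by simp
  ultimately show ?thesis by blast
qed

definition second_moment :: "(int ^ 'd) pmf \<Rightarrow> real" where
  "second_moment p = measure_pmf.expectation p (\<lambda>x. (norm (real_vec x))\<^sup>2)"

lemma inner_sq_le: "(v \<bullet> w)\<^sup>2 \<le> (norm v)\<^sup>2 * (norm w)\<^sup>2" for v w :: "'b::real_inner"
  by (metis Cauchy_Schwarz_ineq power2_norm_eq_inner)

lemma dot_sq_le: "(dot \<theta> x)\<^sup>2 \<le> sq_len \<theta> * (norm (real_vec x))\<^sup>2"
proof -
  have d: "dot \<theta> x = (\<chi> i. \<theta> i) \<bullet> real_vec x"
    by (simp add: dot_def inner_vec_def real_vec_def)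
  have n: "sq_len \<theta> = (norm (\<chi> i. \<theta> i))\<^sup>2"
    by (simp add: sq_len_def norm_vec_def L2_set_def sum_nonneg)
  show ?thesis unfolding d n by (rule inner_sq_le)
qed

lemma one_minus_cos_le: "1 - cos t \<le> t\<^sup>2 / 2" for t :: real
proof -
  have "1 - cos t = 2 * (sin (t / 2))\<^sup>2"
    using cos_double_sin[of "t / 2"] by simp
  also have "(sin (t / 2))\<^sup>2 \<le> (t / 2)\<^sup>2"
    using abs_sin_x_le_abs_x[of "t / 2"] by (simp only: abs_le_square_iff)
  finally show ?thesis by (simp add: power2_eq_square)
qed

text \<open>
  The easy half of the quadratic behaviour at zero, from \<open>1 - cos t \<le> t\<^sup>2 / 2\<close>.
\<close>

lemma char_fun_ge:
  assumes "integrable (measure_pmf p) (\<lambda>x. (norm (real_vec x))\<^sup>2)"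
  shows "1 - second_moment p / 2 * sq_len \<theta> \<le> char_fun p \<theta>"
proof -
  have "1 - char_fun p \<theta> = measure_pmf.expectation p (\<lambda>x. 1 - cos (dot \<theta> x))"
    unfolding char_fun_def by (subst Bochner_Integration.integral_diff) (auto intro: integrable_pmf_cos)
  also have "\<dots> \<le> measure_pmf.expectation p (\<lambda>x. sq_len \<theta> / 2 * (norm (real_vec x))\<^sup>2)"
  proof (intro integral_mono integrable_mult_right assms Bochner_Integration.integrable_diff integrable_pmf_cos)
    fix x
    show "1 - cos (dot \<theta> x) \<le> sq_len \<theta> / 2 * (norm (real_vec x))\<^sup>2"
      using one_minus_cos_le[of "dot \<theta> x"] dot_sq_le[of \<theta> x] by simp
  qed simp
  also have "\<dots> = second_moment p / 2 * sq_len \<theta>"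
    by (simp add: second_moment_def)
  finally show ?thesis by simp
qed

section \<open>Bounds for the Green function\<close>

text \<open>
  The full series equals 2 for every \<open>n\<close>: it is the expected time that a lazy walk, which moves with
  probability \<open>1 / 2\<close>, spends while having made exactly \<open>n\<close> moves. Pascal's rule bounds the sum for
  \<open>n + 1\<close> by the mean of the sums for \<open>n\<close> and \<open>n + 1\<close>.
\<close>

lemma binomial_geometric_sum_le: "(\<Sum>m<M. real (m choose n) / 2 ^ m) \<le> 2"
proof (induction n arbitrary: M)
  case 0
  have "(\<Sum>m<M. real (m choose 0) / 2 ^ m) = 2 - 2 / 2 ^ M"
    by (induction M) (simp_all add: field_simps)
  then show ?case by simp
next
  case (Suc n)
  show ?case
  proof (induction M)
    case (Suc M)
    have "(\<Sum>m<Suc M. real (m choose Suc n) / 2 ^ m)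
        = (\<Sum>m<M. real (Suc m choose Suc n) / 2 ^ Suc m)"
      by (subst sum.lessThan_Suc_shift) simp
    also have "\<dots> = (\<Sum>m<M. real (m choose n) / 2 ^ m) / 2 + (\<Sum>m<M. real (m choose Suc n) / 2 ^ m) / 2"
      by (simp add: sum.distrib[symmetric] sum_divide_distrib add_divide_distrib mult.commute)
    also have "\<dots> \<le> 2 / 2 + 2 / 2"
      using \<open>\<And>M. (\<Sum>m<M. real (m choose n) / 2 ^ m) \<le> 2\<close> Suc
      by (intro add_mono divide_right_mono) auto
    finally show ?case by simp
  qed simp
qed

text \<open>
  The characteristic function of the lazy walk, which stands still with probability \<open>1 / 2\<close>. It
  lies in \<open>[0, 1]\<close>, so its powers are nonnegative and are small outside a neighbourhood of zero, also
  when the walk itself has period two and \<open>char_fun\<close> comes close to \<open>-1\<close>.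
\<close>

definition lazy_char :: "(int ^ 'd) pmf \<Rightarrow> ('d::finite \<Rightarrow> real) \<Rightarrow> real" where
  "lazy_char p \<theta> = (1 + char_fun p \<theta>) / 2"

lemma measurable_lazy_char [measurable]: "lazy_char p \<in> borel_measurable torus"
  unfolding lazy_char_def[abs_def] by measurable

lemma lazy_char_bounds: "0 \<le> lazy_char p \<theta>" "lazy_char p \<theta> \<le> 1"
  using char_fun_bounds[of p \<theta>] by (auto simp: lazy_char_def)

lemma integrable_torus_bounded:
  fixes f :: "('d::finite \<Rightarrow> real) \<Rightarrow> real"
  assumes "f \<in> borel_measurable torus" "\<And>x. \<bar>f x\<bar> \<le> B"
  shows "integrable torus f"
  using assms by (intro torus.integrable_const_bound[where B = B]) auto

lemma lazy_power_expansion: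
  "lazy_char p \<theta> ^ m = (\<Sum>n\<le>m. real (m choose n) / 2 ^ m * char_fun p \<theta> ^ n)"
proof -
  have "lazy_char p \<theta> ^ m = (char_fun p \<theta> + 1) ^ m / 2 ^ m"
    by (simp add: lazy_char_def power_divide add.commute)
  then show ?thesis by (subst (asm) binomial_ring) (simp add: sum_divide_distrib)
qed

lemma integrable_char_power_cos: "integrable torus (\<lambda>\<theta>. char_fun p \<theta> ^ n * cos (dot \<theta> y))"
  by (intro integrable_torus_bounded[where B = 1])
     (auto simp: abs_mult power_abs intro!: mult_le_one power_le_one char_fun_bounds)

text \<open>
  Expanding the powers of the lazy characteristic function binomially, every \<open>step_prob p z n y\<close>
  receives total weight at most 2. Hence the Green function of the lazy walk, summed over
  any window of times, is up to the factor 2 a lower bound for the one of the walk itself.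
\<close>

lemma lazy_sum_le_step_sum:
  assumes "symmetric_law p"
  shows "(\<Sum>m\<in>{T..<U}. \<integral>\<theta>. lazy_char p \<theta> ^ m * cos (dot \<theta> (y - z)) \<partial>torus)
           \<le> 2 * (\<Sum>n<U. step_prob p z n y)"
proof -
  have "(\<integral>\<theta>. lazy_char p \<theta> ^ m * cos (dot \<theta> (y - z)) \<partial>torus)
      = (\<Sum>n<U. real (m choose n) / 2 ^ m * step_prob p z n y)" if "m < U" for m
  proof -
    have "(\<integral>\<theta>. lazy_char p \<theta> ^ m * cos (dot \<theta> (y - z)) \<partial>torus)
       = (\<integral>\<theta>. (\<Sum>n\<le>m. real (m choose n) / 2 ^ m * (char_fun p \<theta> ^ n * cos (dot \<theta> (y - z)))) \<partial>torus)"
      unfolding lazy_power_expansion by (simp only: sum_distrib_right mult.assoc)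
    also have "\<dots> = (\<Sum>n\<le>m. real (m choose n) / 2 ^ m * step_prob p z n y)"
      unfolding step_prob_fourier[OF assms]
      by (subst Bochner_Integration.integral_sum) (auto intro!: integrable_mult_right integrable_char_power_cos
           simp del: times_divide_eq_left)
    also have "\<dots> = (\<Sum>n<U. real (m choose n) / 2 ^ m * step_prob p z n y)"
      using that by (intro sum.mono_neutral_left) (auto simp: binomial_eq_0)
    finally show ?thesis .
  qed
  then have "(\<Sum>m\<in>{T..<U}. \<integral>\<theta>. lazy_char p \<theta> ^ m * cos (dot \<theta> (y - z)) \<partial>torus)
     = (\<Sum>m\<in>{T..<U}. \<Sum>n<U. real (m choose n) / 2 ^ m * step_prob p z n y)" by simp
  also have "\<dots> = (\<Sum>n<U. (\<Sum>m\<in>{T..<U}. real (m choose n) / 2 ^ m) * step_prob p z n y)"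
    by (subst sum.swap) (simp add: sum_distrib_right)
  also have "\<dots> \<le> (\<Sum>n<U. 2 * step_prob p z n y)"
  proof (intro sum_mono mult_right_mono step_prob_nonneg)
    fix n
    have "(\<Sum>m\<in>{T..<U}. real (m choose n) / 2 ^ m) \<le> (\<Sum>m<U. real (m choose n) / 2 ^ m)"
      by (intro sum_mono2) auto
    then show "(\<Sum>m\<in>{T..<U}. real (m choose n) / 2 ^ m) \<le> 2"
      using binomial_geometric_sum_le[where n = n and M = U] by linarith
  qed
  finally show ?thesis by (simp add: sum_distrib_left)
qed

text \<open>
  Compare with the integral of the normal density with variance \<open>1 / (2 * b)\<close> over the whole line.
\<close>

lemma circle_gaussian_le:
  assumes "b > 0"
  shows "integral\<^sup>L circle (\<lambda>t. exp (- (b * t\<^sup>2))) \<le> 1 / sqrt b"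
proof -
  define \<sigma> where "\<sigma> = 1 / sqrt (2 * b)"
  have sq: "2 * \<sigma>\<^sup>2 = 1 / b" using assms by (simp add: \<sigma>_def power_divide)
  have nd: "exp (- (b * t\<^sup>2)) = sqrt (pi / b) * normal_density 0 \<sigma> t" for t
  proof -
    have "2 * pi * \<sigma>\<^sup>2 = pi / b" using sq by (simp add: field_simps)
    moreover have "- (t - 0)\<^sup>2 / (2 * \<sigma>\<^sup>2) = - (b * t\<^sup>2)" unfolding sq by simp
    ultimately show ?thesis using assms by (simp add: normal_density_def)
  qed
  have val: "integral\<^sup>L circle (\<lambda>t. exp (- (b * t\<^sup>2)))
      = (1 / (2 * pi)) * (\<integral>t. indicator {-pi..pi} t * exp (- (b * t\<^sup>2)) \<partial>lborel)"
    by (subst integral_circle) auto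
  have "(\<integral>t. indicator {-pi..pi} t * exp (- (b * t\<^sup>2)) \<partial>lborel)
      \<le> (\<integral>t. sqrt (pi / b) * normal_density 0 \<sigma> t \<partial>lborel)"
  proof (rule integral_mono_AE')
    show "integrable lborel (\<lambda>t. sqrt (pi / b) * normal_density 0 \<sigma> t)"
      using assms by (intro integrable_mult_right) (simp add: \<sigma>_def)
  qed (auto simp: nd[symmetric] indicator_def)
  also have "\<dots> = sqrt (pi / b)"
    using integral_normal_density[of \<sigma> 0] assms by (simp add: \<sigma>_def)
  finally have "integral\<^sup>L circle (\<lambda>t. exp (- (b * t\<^sup>2))) \<le> 1 / (2 * pi) * sqrt (pi / b)"
    unfolding val by (intro mult_left_mono) auto
  also have "\<dots> = (sqrt pi / (2 * pi)) * (1 / sqrt b)" by (simp add: real_sqrt_divide)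
  also have "sqrt pi / (2 * pi) \<le> 1"
  proof -
    have "sqrt pi \<le> pi" using pi_ge_two by (intro real_le_lsqrt) (auto simp: power2_eq_square)
    then have "sqrt pi \<le> 2 * pi" using pi_gt_zero by linarith
    then show ?thesis by (simp add: divide_le_eq)
  qed
  then have "(sqrt pi / (2 * pi)) * (1 / sqrt b) \<le> 1 * (1 / sqrt b)"
    using assms by (intro mult_right_mono) auto
  finally show ?thesis by simp
qed

lemma torus_gaussian:
  assumes "b > 0"
  shows "integrable torus (\<lambda>\<theta>::'d::finite \<Rightarrow> real. exp (- (b * sq_len \<theta>)))"
    and "(\<integral>\<theta>. exp (- (b * sq_len (\<theta>::'d \<Rightarrow> real))) \<partial>torus) \<le> (1 / sqrt b) ^ CARD('d)"
proof -
  have eq: "exp (- (b * sq_len \<theta>)) = (\<Prod>i\<in>UNIV. exp (- (b * (\<theta> i)\<^sup>2)))" for \<theta> :: "'d \<Rightarrow> real"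
    by (simp add: sq_len_def exp_sum[symmetric] sum_distrib_left sum_negf)
  have int: "integrable circle (\<lambda>t. exp (- (b * t\<^sup>2)))"
    by (rule integrable_circle_bounded[where B = 1]) (use assms in auto)
  show "integrable torus (\<lambda>\<theta>::'d \<Rightarrow> real. exp (- (b * sq_len \<theta>)))"
    unfolding eq by (rule torus_integral_prod(2)) (rule int)
  show "(\<integral>\<theta>. exp (- (b * sq_len (\<theta>::'d \<Rightarrow> real))) \<partial>torus) \<le> (1 / sqrt b) ^ CARD('d)"
    unfolding eq by (subst torus_integral_prod(1))
      (auto intro!: int power_mono circle_gaussian_le assms integral_nonneg_AE)
qed

lemma torus_cube:
  assumes "0 \<le> a" "a \<le> pi"
  shows "integrable torus (\<lambda>\<theta>::'d::finite \<Rightarrow> real. \<Prod>i\<in>UNIV. indicator {-a..a} (\<theta> i) :: real)"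
    and "(\<integral>\<theta>. (\<Prod>i\<in>(UNIV::'d set). indicator {-a..a} (\<theta> i)) \<partial>torus) = (a / pi) ^ CARD('d)"
proof -
  have int: "integrable circle (indicator {-a..a} :: real \<Rightarrow> real)"
    by (rule integrable_circle_bounded[where B = 1]) auto
  have "integral\<^sup>L circle (indicator {-a..a}) = (1 / (2 * pi)) * (\<integral>t. indicator {-pi..pi} t * indicator {-a..a} t \<partial>lborel)"
    by (subst integral_circle) auto
  also have "(\<lambda>t. indicator {-pi..pi} t * indicator {-a..a} t :: real) = indicator {-a..a}"
    using assms by (auto simp: indicator_def fun_eq_iff)
  finally have val: "integral\<^sup>L circle (indicator {-a..a}) = a / pi" using assms by simp
  show "integrable torus (\<lambda>\<theta>::'d \<Rightarrow> real. \<Prod>i\<in>UNIV. indicator {-a..a} (\<theta> i) :: real)"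
    by (rule torus_integral_prod(2)) (rule int)
  show "(\<integral>\<theta>. (\<Prod>i\<in>(UNIV::'d set). indicator {-a..a} (\<theta> i)) \<partial>torus) = (a / pi) ^ CARD('d)"
    unfolding torus_integral_prod(1)[OF int] val by simp
qed

text \<open>
  One half of a local limit estimate. The integral at \<open>y = 0\<close> is at least of order
  \<open>m\<close> to the power \<open>-d / 2\<close>, because the integrand is at least \<open>1 / 2\<close> on a cube of side of order
  \<open>1 / sqrt m\<close>. Replacing 1 by \<open>cos (dot \<theta> y)\<close> costs at most \<open>|y|\<^sup>2 / 2\<close> times the integral of
  \<open>lazy_char p \<theta> ^ m * sq_len \<theta>\<close>, which is smaller by a factor of order \<open>m\<close> by Gaussian domination.
  So the loss is harmless once \<open>m\<close> exceeds a multiple of \<open>|y|\<^sup>2\<close>.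
\<close>

lemma lazy_integral_lower:
  fixes p :: "(int ^ 'd) pmf"
  assumes gen: "generates_lattice p" and mom: "integrable (measure_pmf p) (\<lambda>x. (norm (real_vec x))\<^sup>2)"
  shows "\<exists>c>0. \<exists>K\<ge>1. \<forall>m y. m \<ge> 1 \<longrightarrow> K * (norm (real_vec y))\<^sup>2 \<le> real m \<longrightarrow>
           c * (1 / sqrt (real m)) ^ CARD('d) \<le> (\<integral>\<theta>. lazy_char p \<theta> ^ m * cos (dot \<theta> y) \<partial>torus)"
proof -
  obtain c0 where c0: "c0 > 0" and upper: "\<And>\<theta>. (\<forall>i. \<bar>\<theta> i\<bar> \<le> pi) \<Longrightarrow> char_fun p \<theta> \<le> 1 - c0 * sq_len \<theta>"
    using char_fun_le[OF gen] by blast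
  define d where "d = CARD('d)"
  have d: "d \<ge> 1" by (simp add: d_def Suc_le_eq)
  define C0 where "C0 = second_moment p / 4 + 1"
  have C0: "C0 \<ge> 1" by (simp add: C0_def second_moment_def integral_nonneg_AE)
  have lower: "1 - lazy_char p \<theta> \<le> C0 * sq_len \<theta>" for \<theta>
    using char_fun_ge[OF mom, of \<theta>] sq_len_nonneg[of \<theta>] by (simp add: lazy_char_def C0_def algebra_simps add_divide_distrib)
  \<comment> \<open>A is the constant of the cube bound and B that of the error term; K makes the error at most
    half of the main term.\<close>
  define A where "A = (1 / (pi * sqrt (2 * C0 * d))) ^ d / 2"
  define B where "B = 2 / c0 * (2 / sqrt c0) ^ d"
  have A: "A > 0" unfolding A_def using C0 d by simp
  have B: "B > 0" unfolding B_def using c0 by simp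
  define K where "K = max 1 (2 * B / A)"
  have "A / 2 * (1 / sqrt (real m)) ^ d \<le> (\<integral>\<theta>. lazy_char p \<theta> ^ m * cos (dot \<theta> y) \<partial>torus)"
    if m: "m \<ge> 1" and Km: "K * (norm (real_vec y))\<^sup>2 \<le> real m" for m y
  proof -
    define n2 where "n2 = (norm (real_vec y))\<^sup>2"
    define s where "s = (1 / sqrt (real m)) ^ d"
    have s: "s > 0" using m by (simp add: s_def)
    have int0: "integrable torus (\<lambda>\<theta>. lazy_char p \<theta> ^ m)"
      by (rule integrable_torus_bounded[where B = 1])
         (auto simp: power_abs lazy_char_bounds intro!: power_le_one)
    have int1: "integrable torus (\<lambda>\<theta>. lazy_char p \<theta> ^ m * cos (dot \<theta> y))"
      by (rule integrable_torus_bounded[where B = 1])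
         (auto simp: abs_mult power_abs lazy_char_bounds intro!: power_le_one mult_le_one)
    have main: "A * s \<le> (\<integral>\<theta>. lazy_char p \<theta> ^ m \<partial>torus)"
    proof -
      \<comment> \<open>Half the side of the cube: on it the integrand is at least 1 - m * (1 / (2 m)) = 1 / 2 by
        Bernoulli's inequality.\<close>
      define a where "a = 1 / sqrt (2 * C0 * d * m)"
      have sq1: "1 \<le> 2 * C0 * d * m"
      proof -
        have "1 \<le> C0 * d" using C0 d by (metis mult_mono mult_1 of_nat_1 of_nat_mono zero_le_one order_trans)
        then have "1 * 1 \<le> (C0 * d) * m" using m by (intro mult_mono) auto
        then show ?thesis by simp
      qed
      then have a: "0 \<le> a" "a \<le> 1" by (auto simp: a_def)
      have "A * s = (a / pi) ^ d / 2"
        by (simp add: A_def s_def a_def power_mult_distrib[symmetric] real_sqrt_mult mult_ac)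
      also have "\<dots> = (\<integral>\<theta>. (1/2) * (\<Prod>i\<in>(UNIV::'d set). indicator {-a..a} (\<theta> i)) \<partial>torus)"
        using torus_cube(2)[of a, where 'd = 'd] a pi_ge_two by (simp add: d_def)
      also have "\<dots> \<le> (\<integral>\<theta>. lazy_char p \<theta> ^ m \<partial>torus)"
      proof (intro integral_mono int0 integrable_mult_right torus_cube(1))
        fix \<theta> :: "'d \<Rightarrow> real"
        show "1/2 * (\<Prod>i\<in>UNIV. indicator {-a..a} (\<theta> i)) \<le> lazy_char p \<theta> ^ m"
        proof (cases "\<forall>i. \<theta> i \<in> {-a..a}")
          case True
          have "sq_len \<theta> \<le> (\<Sum>i\<in>(UNIV::'d set). a\<^sup>2)"
            unfolding sq_len_def using True
            by (intro sum_mono) (metis abs_le_iff abs_le_square_iff abs_of_nonneg a(1) atLeastAtMost_iff minus_le_iff)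
          also have "\<dots> = 1 / (2 * C0 * m)"
            using d C0 by (simp add: a_def power_divide d_def)
          finally have "C0 * sq_len \<theta> \<le> C0 * (1 / (2 * C0 * m))"
            using C0 by (intro mult_left_mono) auto
          then have le: "1 - lazy_char p \<theta> \<le> 1 / (2 * m)" using lower[of \<theta>] C0 by simp
          have "1 + real m * (lazy_char p \<theta> - 1) \<le> (1 + (lazy_char p \<theta> - 1)) ^ m"
            by (rule Bernoulli_inequality) (use lazy_char_bounds[of p \<theta>] in auto)
          moreover have "real m * (1 - lazy_char p \<theta>) \<le> real m * (1 / (2 * m))"
            using le by (intro mult_left_mono) auto
          ultimately have "1 / 2 \<le> lazy_char p \<theta> ^ m" using m by (simp add: algebra_simps)
          then show ?thesis using True by (simp add: indicator_def)
        next
          case False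
          then have zero: "(\<Prod>i\<in>UNIV. indicator {-a..a} (\<theta> i) :: real) = 0"
            by (intro prod_zero) (auto simp: indicator_def)
          show ?thesis unfolding zero using lazy_char_bounds[of p \<theta>] by simp
        qed
      qed (use a pi_ge_two in auto)
      finally show ?thesis .
    qed
    \<comment> \<open>Half of the Gaussian decay is spent on absorbing the factor sq_len, through x * exp (- x) \<le> 1.\<close>
    define b where "b = c0 * m / 4"
    have b: "b > 0" using c0 m by (simp add: b_def)
    have AEb: "AE \<theta> in torus. lazy_char p \<theta> ^ m * sq_len \<theta> \<le> (1 / b) * exp (- (b * sq_len \<theta>))"
      using AE_torus_box
    proof eventually_elim
      case (elim \<theta>)
      define W where "W = sq_len \<theta>"
      have W: "0 \<le> W" by (simp add: W_def sq_len_nonneg)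
      have "lazy_char p \<theta> \<le> 1 + (- (c0 / 2 * W))" using upper[OF elim] by (simp add: lazy_char_def W_def)
      also have "\<dots> \<le> exp (- (c0 / 2 * W))" by (rule exp_ge_add_one_self)
      finally have "lazy_char p \<theta> ^ m \<le> exp (- (c0 / 2 * W)) ^ m"
        using lazy_char_bounds by (intro power_mono) auto
      also have "\<dots> = exp (- (b * W)) * exp (- (b * W))"
        by (simp add: exp_of_nat_mult[symmetric] exp_add[symmetric] b_def)
      finally have "lazy_char p \<theta> ^ m * W \<le> exp (- (b * W)) * (exp (- (b * W)) * W)"
        using W by (simp add: mult_right_mono mult.assoc[symmetric])
      also have "\<dots> \<le> exp (- (b * W)) * (1 / b)"
      proof (intro mult_left_mono)
        have "b * W \<le> exp (b * W)" using exp_ge_add_one_self[of "b * W"] by linarith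
        then show "exp (- (b * W)) * W \<le> 1 / b" using b by (simp add: exp_minus field_simps)
      qed simp
      finally show ?case by (simp add: W_def mult.commute)
    qed
    have int2: "integrable torus (\<lambda>\<theta>. lazy_char p \<theta> ^ m * sq_len \<theta>)"
    proof (rule Bochner_Integration.integrable_bound[OF integrable_mult_right[OF torus_gaussian(1)[OF b]]])
      show "AE x in torus. norm (lazy_char p x ^ m * sq_len x) \<le> norm (1 / b * exp (- (b * sq_len x)))"
        using AEb by eventually_elim (use b in \<open>simp add: abs_mult sq_len_nonneg lazy_char_bounds\<close>)
    qed measurable
    have "(\<integral>\<theta>. lazy_char p \<theta> ^ m * sq_len \<theta> \<partial>torus) \<le> (\<integral>\<theta>. (1 / b) * exp (- (b * sq_len (\<theta>::'d \<Rightarrow> real))) \<partial>torus)"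
      by (rule integral_mono_AE[OF int2 _ AEb]) (intro integrable_mult_right torus_gaussian(1) b)
    also have "\<dots> = (1 / b) * (\<integral>\<theta>. exp (- (b * sq_len (\<theta>::'d \<Rightarrow> real))) \<partial>torus)" by simp
    also have "\<dots> \<le> (1 / b) * (1 / sqrt b) ^ d"
      unfolding d_def using b by (intro mult_left_mono torus_gaussian(2)) auto
    also have "\<dots> = 2 * B * s / m"
      using c0 m by (simp add: b_def B_def s_def real_sqrt_divide real_sqrt_mult power_divide power_mult_distrib field_simps)
    finally have err: "(\<integral>\<theta>. lazy_char p \<theta> ^ m * sq_len \<theta> \<partial>torus) \<le> 2 * B * s / m" .
    have "n2 * B / m \<le> A / 2"
    proof -
      have "2 * B / A * n2 \<le> K * n2" unfolding K_def n2_def by (intro mult_right_mono) auto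
      also have "\<dots> \<le> m" using Km by (simp add: n2_def)
      finally show ?thesis using A m by (simp add: field_simps)
    qed
    then have "n2 * B / m * s \<le> A / 2 * s" using s by (intro mult_right_mono) auto
    then have "A / 2 * s \<le> A * s - n2 / 2 * (2 * B * s / m)" by (simp add: field_simps)
    also have "\<dots> \<le> (\<integral>\<theta>. lazy_char p \<theta> ^ m \<partial>torus) - n2 / 2 * (\<integral>\<theta>. lazy_char p \<theta> ^ m * sq_len \<theta> \<partial>torus)"
      using main err by (intro diff_mono mult_left_mono) (auto simp: n2_def)
    also have "\<dots> = (\<integral>\<theta>. lazy_char p \<theta> ^ m - n2 / 2 * (lazy_char p \<theta> ^ m * sq_len \<theta>) \<partial>torus)"
      by (subst Bochner_Integration.integral_diff[OF int0 integrable_mult_right[OF int2]]) simp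
    also have "\<dots> \<le> (\<integral>\<theta>. lazy_char p \<theta> ^ m * cos (dot \<theta> y) \<partial>torus)"
    proof (intro integral_mono int1 Bochner_Integration.integrable_diff[OF int0 integrable_mult_right[OF int2]])
      fix \<theta>
      have "1 - n2 / 2 * sq_len \<theta> \<le> cos (dot \<theta> y)"
        using one_minus_cos_le[of "dot \<theta> y"] dot_sq_le[of \<theta> y] by (simp add: n2_def mult.commute)
      then have "lazy_char p \<theta> ^ m * (1 - n2 / 2 * sq_len \<theta>) \<le> lazy_char p \<theta> ^ m * cos (dot \<theta> y)"
        by (intro mult_left_mono) (auto simp: lazy_char_bounds)
      then show "lazy_char p \<theta> ^ m - n2 / 2 * (lazy_char p \<theta> ^ m * sq_len \<theta>) \<le> lazy_char p \<theta> ^ m * cos (dot \<theta> y)"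
        by (simp add: algebra_simps)
    qed
    finally show ?thesis by (simp add: s_def)
  qed
  moreover have "A / 2 > 0" "K \<ge> 1" using A by (auto simp: K_def)
  ultimately show ?thesis unfolding d_def by blast
qed

lemma real_vec_uminus: "real_vec (- x) = - real_vec x"
  by (simp add: real_vec_def vec_eq_iff)

lemma norm_real_vec_ge_1:
  assumes "x \<noteq> 0"
  shows "1 \<le> norm (real_vec x)"
proof -
  obtain i where i: "x $ i \<noteq> 0" using assms by (auto simp: vec_eq_iff)
  then have "1 \<le> \<bar>real_vec x $ i\<bar>" by (simp add: real_vec_def)
  also have "\<dots> \<le> norm (real_vec x)" by (rule component_le_norm_cart)
  finally show ?thesis .
qed

text \<open>
  The window of times from \<open>T\<close> to \<open>2 T\<close> with \<open>T\<close> comparable to \<open>r\<^sup>2\<close>, where \<open>r = |y - z|\<close>, contributes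
  \<open>T\<close> terms of order \<open>T\<close> to the power \<open>-d / 2\<close>, in total a multiple of \<open>r\<close> to the power \<open>2 - d\<close>.
\<close>

lemma green_lower:
  fixes p :: "(int ^ 'd) pmf"
  assumes dim: "CARD('d) \<ge> 3" and sym: "symmetric_law p"
    and gen: "generates_lattice p" and mom: "integrable (measure_pmf p) (\<lambda>x. (norm (real_vec x))\<^sup>2)"
  shows "\<exists>c>0. \<forall>y z. y \<noteq> z \<longrightarrow> (\<exists>N. c * (1 / norm (real_vec (y - z))) ^ (CARD('d) - 2)
           \<le> (\<Sum>n=1..N. step_prob p z n y))"
proof -
  obtain c K where c: "c > 0" and K: "K \<ge> 1" and low: "\<And>m y. m \<ge> 1 \<Longrightarrow> K * (norm (real_vec y))\<^sup>2 \<le> real m \<Longrightarrow>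
           c * (1 / sqrt (real m)) ^ CARD('d) \<le> (\<integral>\<theta>. lazy_char p \<theta> ^ m * cos (dot \<theta> y) \<partial>torus)"
    using lazy_integral_lower[OF gen mom] by blast
  define e where "e = CARD('d) - 2"
  have e: "CARD('d) = e + 2" using dim by (simp add: e_def)
  define c' where "c' = c / 4 * (1 / sqrt (4 * K)) ^ e"
  have "\<exists>N. c' * (1 / norm (real_vec (y - z))) ^ e \<le> (\<Sum>n=1..N. step_prob p z n y)" if "y \<noteq> z" for y z
  proof -
    define r where "r = norm (real_vec (y - z))"
    have r: "r \<ge> 1" unfolding r_def using that by (intro norm_real_vec_ge_1) simp
    define T where "T = nat \<lceil>K * r\<^sup>2\<rceil>"
    have r2: "1 \<le> r\<^sup>2" using r by simp
    have Kr: "1 \<le> K * r\<^sup>2" using mult_mono[OF K r2] K by simp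
    have T: "K * r\<^sup>2 \<le> real T" "real T \<le> 2 * (K * r\<^sup>2)" "T \<ge> 1"
      using Kr unfolding T_def by linarith+
    have term_low: "c * (1 / sqrt (2 * real T)) ^ CARD('d) \<le> (\<integral>\<theta>. lazy_char p \<theta> ^ m * cos (dot \<theta> (y - z)) \<partial>torus)"
      if "m \<in> {T..<2 * T}" for m
    proof -
      have "c * (1 / sqrt (2 * real T)) ^ CARD('d) \<le> c * (1 / sqrt (real m)) ^ CARD('d)"
        using that c T(3) by (intro mult_left_mono power_mono divide_left_mono) auto
      also have "\<dots> \<le> (\<integral>\<theta>. lazy_char p \<theta> ^ m * cos (dot \<theta> (y - z)) \<partial>torus)"
        using that T by (intro low) (auto simp: r_def)
      finally show ?thesis .
    qed
    have "c' * (1 / r) ^ e = c / 4 * (1 / sqrt (4 * K * r\<^sup>2)) ^ e"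
      using r by (simp add: c'_def real_sqrt_mult power_mult_distrib power_divide)
    also have "\<dots> \<le> c / 4 * (1 / sqrt (2 * real T)) ^ e"
      using T c Kr by (intro mult_left_mono power_mono divide_left_mono) (auto simp: mult_ac)
    also have "\<dots> = (real T * (c * (1 / sqrt (2 * real T)) ^ CARD('d))) / 2"
      using T(3) unfolding e by (simp add: power_add power2_eq_square field_simps)
    also have "\<dots> = (\<Sum>m\<in>{T..<2 * T}. c * (1 / sqrt (2 * real T)) ^ CARD('d)) / 2" by simp
    also have "\<dots> \<le> (\<Sum>m\<in>{T..<2 * T}. \<integral>\<theta>. lazy_char p \<theta> ^ m * cos (dot \<theta> (y - z)) \<partial>torus) / 2"
      by (intro divide_right_mono sum_mono term_low) auto
    also have "\<dots> \<le> (\<Sum>n<2 * T. step_prob p z n y)"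
      using lazy_sum_le_step_sum[OF sym, where T = T and U = "2 * T" and y = y and z = z] by simp
    also have "\<dots> \<le> (\<Sum>n=0..2 * T. step_prob p z n y)"
      by (intro sum_mono2) (auto simp: step_prob_nonneg)
    also have "\<dots> = (\<Sum>n=1..2 * T. step_prob p z n y)"
      using that by (simp add: sum.atLeast_Suc_atMost)
    finally show ?thesis unfolding r_def by blast
  qed
  moreover have "c' > 0" using c K by (simp add: c'_def)
  ultimately show ?thesis unfolding e_def by blast
qed

lemma integrable_circle_powr:
  assumes "a > -1"
  shows "integrable circle (\<lambda>t. \<bar>t\<bar> powr a)"
proof (rule integrable_circleI)
  have "(\<lambda>x::real. x powr a) absolutely_integrable_on {0..pi}"
    using has_integral_powr_from_0[OF assms pi_ge_zero]
    by (intro nonnegative_absolutely_integrable_1) (auto simp: integrable_on_def)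
  then have "integrable lebesgue (\<lambda>x. indicator {0..pi} x *\<^sub>R (x powr a))"
    unfolding set_integrable_def .
  then have pos: "integrable lborel (\<lambda>x. indicator {0..pi} x *\<^sub>R (x powr a))"
    by (subst (asm) integrable_completion) auto
  have neg: "integrable lborel (\<lambda>x. indicator {0..pi} (- x) *\<^sub>R ((- x) powr a))"
    using lborel_integrable_real_affine[OF pos, of "-1" 0] by simp
  show "integrable lborel (\<lambda>x. indicator {- pi..pi} x *\<^sub>R (\<bar>x\<bar> powr a))"
  proof (rule Bochner_Integration.integrable_bound[OF Bochner_Integration.integrable_add[OF pos neg]])
    show "AE x in lborel. norm (indicat_real {- pi..pi} x *\<^sub>R \<bar>x\<bar> powr a)
      \<le> norm (indicat_real {0..pi} x *\<^sub>R x powr a + indicat_real {0..pi} (- x) *\<^sub>R (- x) powr a)"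
      by (auto simp: indicator_def abs_if)
  qed measurable
qed measurable

text \<open>
  The inequality between the arithmetic and the geometric mean, for the squares of the angles.
\<close>

lemma sq_len_ge_prod:
  fixes \<theta> :: "'d::finite \<Rightarrow> real"
  shows "(\<Prod>i\<in>UNIV. \<bar>\<theta> i\<bar> powr (2 / CARD('d))) \<le> sq_len \<theta>"
proof -
  have "(\<Prod>i\<in>UNIV. \<bar>\<theta> i\<bar> powr (2 / CARD('d))) = (\<Prod>i\<in>UNIV. (\<theta> i)\<^sup>2) powr (1 / CARD('d))"
  proof (subst prod_powr_distrib)
    have "\<bar>\<theta> i\<bar> powr (2 / CARD('d)) = (\<theta> i)\<^sup>2 powr (1 / CARD('d))" for i
    proof -
      have "(\<theta> i)\<^sup>2 powr (1 / CARD('d)) = (\<bar>\<theta> i\<bar> powr 2) powr (1 / CARD('d))"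
        by (cases "\<theta> i = 0") (simp_all add: powr_numeral)
      also have "\<dots> = \<bar>\<theta> i\<bar> powr (2 * (1 / CARD('d)))" by (rule powr_powr)
      finally show ?thesis by simp
    qed
    then show "(\<Prod>i\<in>UNIV. \<bar>\<theta> i\<bar> powr (2 / CARD('d))) = (\<Prod>i\<in>UNIV. (\<theta> i)\<^sup>2 powr (1 / CARD('d)))" by simp
  qed
  also have "\<dots> \<le> (\<Sum>i\<in>UNIV. (\<theta> i)\<^sup>2 / CARD('d))"
    by (rule arith_geom_mean) auto
  also have "\<dots> \<le> sq_len \<theta>"
    unfolding sq_len_def by (intro sum_mono) (simp add: divide_le_eq mult_right_le_one_le mult_le_cancel_left1 Suc_le_eq)
  finally show ?thesis .
qed

text \<open>
  The geometric sum of the powers of the characteristic function is at most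
  \<open>2 / (1 - char_fun p \<theta>)\<close>, hence at most a multiple of \<open>1 / sq_len \<theta>\<close>. By the inequality of means
  this is dominated by the product of the functions \<open>\<bar>\<theta> i\<bar> powr (- 2 / d)\<close>, each of which is
  integrable because \<open>d \<ge> 3\<close>.
\<close>

lemma green_bounded:
  fixes p :: "(int ^ 'd) pmf"
  assumes dim: "CARD('d) \<ge> 3" and sym: "symmetric_law p" and gen: "generates_lattice p"
  shows "\<exists>G>0. \<forall>N z. (\<Sum>n\<le>N. step_prob p z n z) \<le> G"
proof -
  obtain c0 where c0: "c0 > 0" and upper: "\<And>\<theta>. (\<forall>i. \<bar>\<theta> i\<bar> \<le> pi) \<Longrightarrow> char_fun p \<theta> \<le> 1 - c0 * sq_len \<theta>"
    using char_fun_le[OF gen] by blast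
  define a where "a = - (2 / CARD('d))"
  have a: "a > -1" using dim by (simp add: a_def)
  define f where "f = (\<lambda>\<theta>::'d \<Rightarrow> real. 2 / c0 * (\<Prod>i\<in>UNIV. \<bar>\<theta> i\<bar> powr a))"
  have f: "integrable torus f"
    unfolding f_def by (intro integrable_mult_right torus_integral_prod(2) integrable_circle_powr a)
  have "(\<Sum>n\<le>N. step_prob p z n z) \<le> integral\<^sup>L torus f" for N z
  proof -
    have int: "integrable torus (\<lambda>\<theta>. char_fun p \<theta> ^ n)" for n
      using integrable_char_power_cos[of p n 0] by simp
    have "(\<Sum>n\<le>N. step_prob p z n z) = (\<integral>\<theta>. (\<Sum>n\<le>N. char_fun p \<theta> ^ n) \<partial>torus)"
      by (simp add: step_prob_fourier[OF sym] Bochner_Integration.integral_sum int)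
    also have "\<dots> \<le> integral\<^sup>L torus f"
    proof (rule integral_mono_AE[OF _ f])
      show "AE \<theta> in torus. (\<Sum>n\<le>N. char_fun p \<theta> ^ n) \<le> f \<theta>"
        using AE_torus_box AE_torus_nonzero
      proof eventually_elim
        case (elim \<theta>)
        define P where "P = (\<Prod>i\<in>UNIV. \<bar>\<theta> i\<bar> powr (2 / CARD('d)))"
        have P: "P > 0" unfolding P_def using elim(2) by (intro prod_pos) simp
        have "(1 - char_fun p \<theta>) * (\<Sum>n\<le>N. char_fun p \<theta> ^ n) = 1 - char_fun p \<theta> ^ Suc N"
          using sum_gp_basic[of "char_fun p \<theta>" N] .
        also have "\<dots> \<le> 2"
        proof -
          have "\<bar>char_fun p \<theta> ^ Suc N\<bar> \<le> 1"
            unfolding power_abs by (intro power_le_one char_fun_bounds) auto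
          then show ?thesis by linarith
        qed
        finally have sum: "(1 - char_fun p \<theta>) * (\<Sum>n\<le>N. char_fun p \<theta> ^ n) \<le> 2" .
        have "c0 * P \<le> c0 * sq_len \<theta>" using sq_len_ge_prod[of \<theta>] c0 by (simp add: P_def)
        then have le: "c0 * P \<le> 1 - char_fun p \<theta>" using upper[OF elim(1)] by linarith
        moreover have cP: "c0 * P > 0" using c0 P by simp
        ultimately have "(\<Sum>n\<le>N. char_fun p \<theta> ^ n) \<le> 2 / (1 - char_fun p \<theta>)"
          using sum by (simp add: pos_le_divide_eq mult.commute)
        also have "\<dots> \<le> 2 / (c0 * P)" using le cP by (intro divide_left_mono) auto
        also have "\<dots> = f \<theta>"
          by (simp add: f_def P_def a_def powr_minus divide_inverse prod_inversef[symmetric] comp_def)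
        finally show ?case .
      qed
    qed (intro Bochner_Integration.integrable_sum int)
    finally show ?thesis .
  qed
  then show ?thesis by (intro exI[of _ "max 1 (integral\<^sup>L torus f)"]) (auto simp: le_max_iff_disj)
qed

section \<open>Visit counts of finite paths\<close>

text \<open>
  The number of times from 1 to the length of the list at which the path that starts at \<open>y\<close> and has
  these steps is at \<open>z\<close>.
\<close>

primrec visits :: "'v::ab_group_add \<Rightarrow> 'v \<Rightarrow> 'v list \<Rightarrow> nat" where
  "visits z y [] = 0"
| "visits z y (x # xs) = of_bool (y + x = z) + visits z (y + x) xs"

lemma visits_append: "visits z y (xs @ ys) = visits z y xs + visits z (y + sum_list xs) ys"
  by (induction xs arbitrary: y) (auto simp: algebra_simps)

lemma visits_shift: "visits (w + z) (w + y) xs = visits z y xs"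
  by (induction xs arbitrary: y) (auto simp: add.assoc)

text \<open>
  Time reversal. Seen from the end point \<open>s\<close> of a path, the earlier positions are reached by running
  through the steps backwards, and a visit to \<open>s + z\<close> is a visit of the reversed path to \<open>- z\<close>.
  The first step is split off because time 0 is not counted: the reversed path then stops at the
  position at time 1. The last summand is the end point itself.
\<close>

lemma visits_rev:
  "visits (x + sum_list xs + z) 0 (x # xs) = visits (- z) 0 (rev xs) + of_bool (z = 0)"
proof (induction xs arbitrary: x)
  case (Cons u us)
  have 1: "(x = x + sum_list (u # us) + z) \<longleftrightarrow> (sum_list (rev us) + u = - z)"
    by (auto simp: algebra_simps eq_neg_iff_add_eq_0)
  have "visits (x + sum_list (u # us) + z) 0 (x # u # us)
      = of_bool (x = x + sum_list (u # us) + z) + visits (x + u + sum_list us + z) 0 ((x + u) # us)"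
    by (simp add: add.assoc)
  also have "\<dots> = visits (- z) 0 (rev (u # us)) + of_bool (z = 0)"
    unfolding Cons 1 by (simp add: visits_append)
  finally show ?case .
qed simp

lemma prob_bind_pmf:
  "measure_pmf.prob (bind_pmf M f) A = measure_pmf.expectation M (\<lambda>x. measure_pmf.prob (f x) A)"
proof -
  have "ennreal (measure_pmf.prob (bind_pmf M f) A) = (\<integral>\<^sup>+x. ennreal (measure_pmf.prob (f x) A) \<partial>M)"
    by (simp add: measure_pmf.emeasure_eq_measure[symmetric])
  also have "\<dots> = ennreal (measure_pmf.expectation M (\<lambda>x. measure_pmf.prob (f x) A))"
    by (intro nn_integral_eq_integral integrable_pmf_bounded[where B = 1]) auto
  finally show ?thesis by (simp add: integral_nonneg_AE)
qed

lemma replicate_pmf_Suc_map: "replicate_pmf (Suc n) p = bind_pmf p (\<lambda>x. map_pmf ((#) x) (replicate_pmf n p))"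
  by (simp add: map_pmf_def)

lemma prob_replicate_pmf_Suc:
  "measure_pmf.prob (replicate_pmf (Suc n) p) A
     = measure_pmf.expectation p (\<lambda>x. measure_pmf.prob (replicate_pmf n p) {xs. x # xs \<in> A})"
  unfolding replicate_pmf_Suc_map prob_bind_pmf by (simp add: vimage_def)

lemma map_rev_replicate_pmf: "map_pmf rev (replicate_pmf n p) = replicate_pmf n p"
proof (induction n)
  case (Suc n)
  have "map_pmf rev (replicate_pmf (Suc n) p)
      = bind_pmf p (\<lambda>x. bind_pmf (map_pmf rev (replicate_pmf n p)) (\<lambda>xs. return_pmf (xs @ [x])))"
    by (simp add: map_bind_pmf bind_map_pmf)
  also have "\<dots> = bind_pmf (replicate_pmf n p) (\<lambda>xs. bind_pmf p (\<lambda>x. return_pmf (xs @ [x])))"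
    unfolding Suc by (rule bind_commute_pmf)
  also have "\<dots> = replicate_pmf (n + 1) p"
    unfolding replicate_pmf_distrib replicate_pmf_1 by (simp add: bind_map_pmf)
  finally show ?case by simp
qed simp

lemma prob_visited_eq_hit_prob:
  "measure_pmf.prob (replicate_pmf n p) {xs. visits z y xs > 0} = hit_prob p {z} {} n y"
proof (induction n arbitrary: y)
  case (Suc n)
  have "measure_pmf.prob (replicate_pmf n p) {xs. visits z y (x # xs) > 0}
      = (if y + x \<in> {z} then 1 else if y + x \<in> {} then 0 else hit_prob p {z} {} n (y + x))" for x
    using Suc[of "y + x"] by auto
  then show ?case unfolding prob_replicate_pmf_Suc by simp
qed simp

text \<open>
  Successive excursions from \<open>w\<close> are independent, and each of the first \<open>a\<close> has to come back to \<open>w\<close>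
  without meeting \<open>z\<close>. For the induction the starting point is arbitrary; the excursion in progress
  then contributes its own hitting probability, and \<open>a\<close> further ones the factor \<open>q ^ a\<close>.
\<close>

lemma prob_returns_avoiding_le:
  assumes "z \<noteq> w" and q: "\<And>n. hit_prob p {w} {z} n w \<le> q"
  shows "measure_pmf.prob (replicate_pmf n p) {xs. visits w w xs \<ge> a \<and> visits z w xs = 0} \<le> q ^ a"
proof -
  have q0: "0 \<le> q" using q[of 0] by simp
  have step: "measure_pmf.prob (replicate_pmf n p) {xs. visits w y xs \<ge> Suc a \<and> visits z y xs = 0}
      \<le> hit_prob p {w} {z} n y * q ^ a" for y n a
  proof (induction n arbitrary: y a)
    case (Suc n)
    let ?h = "\<lambda>x. if y + x \<in> {w} then 1 else if y + x \<in> {z} then 0 else hit_prob p {w} {z} n (y + x)"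
    have "measure_pmf.prob (replicate_pmf (Suc n) p) {xs. visits w y xs \<ge> Suc a \<and> visits z y xs = 0}
      \<le> measure_pmf.expectation p (\<lambda>x. ?h x * q ^ a)"
      unfolding prob_replicate_pmf_Suc
    proof (rule integral_mono)
      fix x
      show "measure_pmf.prob (replicate_pmf n p)
          {xs. x # xs \<in> {xs. visits w y xs \<ge> Suc a \<and> visits z y xs = 0}} \<le> ?h x * q ^ a"
      proof (cases "y + x = w")
        case True
        have "measure_pmf.prob (replicate_pmf n p) {xs. visits w w xs \<ge> a \<and> visits z w xs = 0} \<le> q ^ a"
        proof (cases a)
          case (Suc b)
          have "measure_pmf.prob (replicate_pmf n p) {xs. visits w w xs \<ge> a \<and> visits z w xs = 0}
            \<le> hit_prob p {w} {z} n w * q ^ b" unfolding Suc by (rule Suc.IH)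
          also have "\<dots> \<le> q * q ^ b" by (intro mult_right_mono q zero_le_power q0)
          finally show ?thesis by (simp add: Suc)
        qed simp
        then show ?thesis using True assms(1) by simp
      next
        case False
        then show ?thesis using Suc.IH[of a "y + x"] by (cases "y + x = z") auto
      qed
    qed (intro integrable_hit_step integrable_mult_left integrable_pmf_bounded[where B = 1]; simp)+
    then show ?case by simp
  qed simp
  show ?thesis
  proof (cases a)
    case (Suc b)
    have "measure_pmf.prob (replicate_pmf n p) {xs. visits w w xs \<ge> a \<and> visits z w xs = 0}
      \<le> hit_prob p {w} {z} n w * q ^ b" unfolding Suc by (rule step)
    also have "\<dots> \<le> q * q ^ b" by (intro mult_right_mono q zero_le_power q0)
    finally show ?thesis by (simp add: Suc)
  qed simp
qed

text \<open>
  The returns before and after a given time are independent, so a union over the ways to write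
  \<open>m\<close> as a sum of two counts costs only the factor \<open>m + 1\<close>.
\<close>

lemma prob_pair_returns_avoiding_le:
  fixes z :: "'v::{ab_group_add, countable}"
  assumes "z \<noteq> 0" and q: "\<And>n. hit_prob p {0} {z} n 0 \<le> q" "\<And>n. hit_prob p {0} {- z} n 0 \<le> q"
  shows "measure_pmf.prob (pair_pmf (replicate_pmf b p) (replicate_pmf c p))
     {(us, vs). visits 0 0 us + visits 0 0 vs \<ge> m \<and> visits (- z) 0 us = 0 \<and> visits z 0 vs = 0}
     \<le> real (Suc m) * q ^ m"
proof -
  have q0: "0 \<le> q" using q(1)[of 0] by simp
  define U where "U = (\<lambda>a. {us. visits 0 0 us \<ge> a \<and> visits (- z) 0 us = 0})"
  define V where "V = (\<lambda>a. {vs. visits 0 0 vs \<ge> a \<and> visits z 0 vs = 0})"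
  let ?P = "pair_pmf (replicate_pmf b p) (replicate_pmf c p)"
  have "measure_pmf.prob ?P
     {(us, vs). visits 0 0 us + visits 0 0 vs \<ge> m \<and> visits (- z) 0 us = 0 \<and> visits z 0 vs = 0}
    \<le> measure_pmf.prob ?P (\<Union>a\<in>{..m}. U a \<times> V (m - a))"
  proof (intro measure_pmf.finite_measure_mono subsetI)
    fix r assume "r \<in> {(us, vs). visits 0 0 us + visits 0 0 vs \<ge> m \<and> visits (- z) 0 us = 0 \<and> visits z 0 vs = 0}"
    then obtain us vs where r: "r = (us, vs)" "visits 0 0 us + visits 0 0 vs \<ge> m"
      "visits (- z) 0 us = 0" "visits z 0 vs = 0" by auto
    then have "r \<in> U (min m (visits 0 0 us)) \<times> V (m - min m (visits 0 0 us))"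
      by (auto simp: U_def V_def min_def)
    then show "r \<in> (\<Union>a\<in>{..m}. U a \<times> V (m - a))" by auto
  qed simp
  also have "\<dots> \<le> (\<Sum>a\<in>{..m}. measure_pmf.prob ?P (U a \<times> V (m - a)))"
    by (intro measure_pmf.finite_measure_subadditive_finite) auto
  also have "\<dots> \<le> (\<Sum>a\<in>{..m}. q ^ m)"
  proof (intro sum_mono)
    fix a assume a: "a \<in> {..m}"
    have "measure_pmf.prob ?P (U a \<times> V (m - a))
        = measure_pmf.prob (replicate_pmf b p) (U a) * measure_pmf.prob (replicate_pmf c p) (V (m - a))"
      by (rule measure_pmf_prob_product) auto
    also have "\<dots> \<le> q ^ a * q ^ (m - a)"
      unfolding U_def V_def using assms q0 by (intro mult_mono prob_returns_avoiding_le) auto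
    also have "\<dots> = q ^ m" using a by (simp add: power_add[symmetric])
    finally show "measure_pmf.prob ?P (U a \<times> V (m - a)) \<le> q ^ m" .
  qed
  also have "\<dots> = real (Suc m) * q ^ m" by simp
  finally show ?thesis .
qed

text \<open>
  Conditionally on the first step, the remaining steps up to time \<open>j\<close>, read backwards, and the steps
  after time \<open>j\<close> are independent lists of the same kind. Of the \<open>m + 1\<close> visits to the position at time \<open>j\<close>
  one is the visit at time \<open>j\<close> itself, so \<open>m\<close> visits remain to be distributed. For \<open>j = 0\<close>
  the visit at time \<open>j\<close> is not counted and all returns lie in the future.
\<close>

lemma prob_path_uncovered_favourite_le:
  fixes z :: "'v::{ab_group_add, countable}"
  assumes "z \<noteq> 0" and q: "\<And>n. hit_prob p {0} {z} n 0 \<le> q" "\<And>n. hit_prob p {0} {- z} n 0 \<le> q"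
    and "q \<le> 1" and jN: "j \<le> N"
  shows "measure_pmf.prob (replicate_pmf N p)
      {xs. visits (sum_list (take j xs)) 0 xs \<ge> Suc m \<and> visits (sum_list (take j xs) + z) 0 xs = 0}
      \<le> real (Suc m) * q ^ m"
proof (cases j)
  case 0
  have q0: "0 \<le> q" using q(1)[of 0] by simp
  have "measure_pmf.prob (replicate_pmf N p) {xs. visits 0 0 xs \<ge> Suc m \<and> visits z 0 xs = 0} \<le> q ^ Suc m"
    using assms by (intro prob_returns_avoiding_le) auto
  also have "\<dots> \<le> real (Suc m) * q ^ m"
    using \<open>q \<le> 1\<close> q0 by (auto intro!: mult_right_mono)
  finally show ?thesis using 0 by simp
next
  case (Suc b)
  define c where "c = N - j"
  have N: "N = Suc (b + c)" using Suc jN by (simp add: c_def)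
  let ?E = "{xs. visits (sum_list (take j xs)) 0 xs \<ge> Suc m \<and> visits (sum_list (take j xs) + z) 0 xs = 0}"
  let ?F = "{(us, vs). visits 0 0 us + visits 0 0 vs \<ge> m \<and> visits (- z) 0 us = 0 \<and> visits z 0 vs = 0}"
  have "measure_pmf.prob (replicate_pmf N p) ?E
      = measure_pmf.expectation p (\<lambda>x. measure_pmf.prob (replicate_pmf (b + c) p) {xs. x # xs \<in> ?E})"
    unfolding N by (rule prob_replicate_pmf_Suc)
  also have "\<dots> \<le> measure_pmf.expectation p (\<lambda>x. real (Suc m) * q ^ m)"
  proof (rule integral_mono)
    fix x
    have rep: "replicate_pmf (b + c) p = map_pmf (\<lambda>(us, vs). rev us @ vs) (pair_pmf (replicate_pmf b p) (replicate_pmf c p))"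
    proof -
      have "replicate_pmf (b + c) p = bind_pmf (map_pmf rev (replicate_pmf b p))
          (\<lambda>us. bind_pmf (replicate_pmf c p) (\<lambda>vs. return_pmf (us @ vs)))"
        unfolding map_rev_replicate_pmf by (rule replicate_pmf_distrib)
      then show ?thesis by (simp add: pair_pmf_def map_bind_pmf bind_map_pmf)
    qed
    have "measure_pmf.prob (replicate_pmf (b + c) p) {xs. x # xs \<in> ?E}
      = measure_pmf.prob (pair_pmf (replicate_pmf b p) (replicate_pmf c p))
          {r. case r of (us, vs) \<Rightarrow> x # (rev us @ vs) \<in> ?E}"
      unfolding rep by (simp add: vimage_def case_prod_beta)
    also have "\<dots> \<le> measure_pmf.prob (pair_pmf (replicate_pmf b p) (replicate_pmf c p)) ?F"
    proof (rule measure_pmf.finite_measure_mono_AE)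
      show "AE r in measure_pmf (pair_pmf (replicate_pmf b p) (replicate_pmf c p)).
         r \<in> {r. case r of (us, vs) \<Rightarrow> x # (rev us @ vs) \<in> ?E} \<longrightarrow> r \<in> ?F"
        unfolding AE_measure_pmf_iff
      proof (intro ballI impI)
        fix r assume r: "r \<in> set_pmf (pair_pmf (replicate_pmf b p) (replicate_pmf c p))"
          and rE: "r \<in> {r. case r of (us, vs) \<Rightarrow> x # (rev us @ vs) \<in> ?E}"
        obtain us vs where [simp]: "r = (us, vs)" by (cases r)
        have len: "length us = b" using r by (simp add: set_replicate_pmf)
        define s where "s = x + sum_list (rev us)"
        have take: "take j (x # rev us @ vs) = x # rev us" using len Suc by simp
        have vis: "visits (s + w) 0 (x # rev us @ vs) = visits (- w) 0 us + of_bool (w = 0) + visits w 0 vs" for w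
        proof -
          have "visits (s + w) 0 (x # rev us @ vs) = visits (s + w) 0 (x # rev us) + visits (s + w) (s + 0) vs"
            using visits_append[of "s + w" 0 "x # rev us" vs] by (simp add: s_def)
          then show ?thesis using visits_rev[of x "rev us" w] visits_shift[of s w 0 vs] by (simp add: s_def)
        qed
        have "visits (s + 0) 0 (x # rev us @ vs) \<ge> Suc m" "visits (s + z) 0 (x # rev us @ vs) = 0"
          using rE take by (auto simp: s_def)
        then show "r \<in> ?F" unfolding vis using \<open>z \<noteq> 0\<close> by simp
      qed
    qed simp
    also have "\<dots> \<le> real (Suc m) * q ^ m"
      by (rule prob_pair_returns_avoiding_le[OF assms(1) q])
    finally show "measure_pmf.prob (replicate_pmf (b + c) p) {xs. x # xs \<in> ?E} \<le> real (Suc m) * q ^ m" .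
  qed (auto intro!: integrable_pmf_bounded[where B = 1])
  finally show ?thesis by simp
qed

section \<open>Finite-dimensional laws and local times\<close>

definition steps :: "nat \<Rightarrow> (nat \<Rightarrow> 'a \<Rightarrow> int ^ 'd) \<Rightarrow> 'a \<Rightarrow> (int ^ 'd) list" where
  "steps N X \<omega> = map (\<lambda>k. X k \<omega>) [1..<Suc N]"

lemma length_steps [simp]: "length (steps N X \<omega>) = N"
  by (simp add: steps_def)

lemma walk_eq_sum_list:
  assumes "n \<le> N"
  shows "walk X n \<omega> = sum_list (take n (steps N X \<omega>))"
proof -
  have "take n (steps N X \<omega>) = map (\<lambda>k. X k \<omega>) [1..<Suc n]"
    unfolding steps_def take_map using assms by (subst take_upt) auto
  then show ?thesis
    by (simp add: walk_def interv_sum_list_conv_sum_set_nat atLeastLessThanSuc_atLeastAtMost del: upt_Suc)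
qed

lemma pmf_replicate_pmf:
  "length xs = n \<Longrightarrow> pmf (replicate_pmf n p) xs = (\<Prod>i<n. pmf p (xs ! i))"
proof (induction n arbitrary: xs)
  case (Suc n)
  obtain x ys where xs: "xs = x # ys" "length ys = n" using Suc.prems by (cases xs) auto
  have "pmf (replicate_pmf (Suc n) p) xs
      = measure_pmf.expectation p (\<lambda>u. measure_pmf.prob (replicate_pmf n p) {us. u # us \<in> {xs}})"
    by (simp only: pmf.rep_eq prob_replicate_pmf_Suc)
  also have "(\<lambda>u. measure_pmf.prob (replicate_pmf n p) {us. u # us \<in> {xs}})
      = (\<lambda>u. indicator {x} u * pmf (replicate_pmf n p) ys)"
    by (auto simp: xs fun_eq_iff indicator_def pmf.rep_eq)
  also have "measure_pmf.expectation p \<dots> = pmf p x * pmf (replicate_pmf n p) ys"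
    by (simp add: measure_pmf_single)
  finally show ?case
    by (simp only: prod.lessThan_Suc_shift nth_Cons_0 nth_Cons_Suc xs(1) Suc.IH[OF xs(2)])
qed simp

text \<open>
  Lists of steps form a countable set, so it suffices to compare the probabilities of single lists,
  and these factorise by independence.
\<close>

lemma distr_steps:
  fixes X :: "nat \<Rightarrow> 'a \<Rightarrow> int ^ 'd"
  assumes "iid_steps M X p"
  shows "steps N X \<in> measurable M (count_space UNIV)"
    and "distr M (count_space UNIV) (steps N X) = measure_pmf (replicate_pmf N p)"
proof -
  interpret prob_space M using assms by (simp add: iid_steps_def)
  have indep: "indep_vars (\<lambda>_. count_space UNIV) X {1..}"
    and law: "\<And>k. k \<ge> 1 \<Longrightarrow> distr M (count_space UNIV) (X k) = measure_pmf p"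
    using assms by (auto simp: iid_steps_def)
  have rv: "X k \<in> measurable M (count_space UNIV)" if "k \<ge> 1" for k
    using indep that by (auto simp: indep_vars_def)
  have vimage: "steps N X -` {xs} \<inter> space M
      = (if length xs = N then {\<omega>\<in>space M. \<forall>i\<in>{1..N}. X i \<omega> = xs ! (i - 1)} else {})" for xs
  proof -
    have "(map f [1..<Suc N] = xs) \<longleftrightarrow> (length xs = N \<and> (\<forall>i\<in>{1..N}. f i = xs ! (i - 1)))" for f :: "nat \<Rightarrow> int ^ 'd"
    proof
      assume "map f [1..<Suc N] = xs"
      then show "length xs = N \<and> (\<forall>i\<in>{1..N}. f i = xs ! (i - 1))" by (auto simp del: upt_Suc)
    next
      assume *: "length xs = N \<and> (\<forall>i\<in>{1..N}. f i = xs ! (i - 1))"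
      show "map f [1..<Suc N] = xs"
      proof (rule nth_equalityI)
        show "length (map f [1..<Suc N]) = length xs" using * by simp
        fix i assume "i < length (map f [1..<Suc N])"
        then show "map f [1..<Suc N] ! i = xs ! i" using * by (simp del: upt_Suc)
      qed
    qed
    then show ?thesis unfolding steps_def by (auto simp del: upt_Suc)
  qed
  show meas: "steps N X \<in> measurable M (count_space UNIV)"
  proof (rule measurable_count_space_eq_countable[THEN iffD2, rule_format])
    show "steps N X \<in> space M \<rightarrow> UNIV \<and> (\<forall>a\<in>UNIV. steps N X -` {a} \<inter> space M \<in> sets M)"
    proof (intro conjI ballI)
      fix xs :: "(int ^ 'd) list"
      have "{\<omega>\<in>space M. \<forall>i\<in>{1..N}. X i \<omega> = xs ! (i - 1)} \<in> sets M"
      proof (rule sets.sets_Collect_finite_All)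
        fix i assume i: "i \<in> {1..N}"
        have "X i -` {xs ! (i - 1)} \<inter> space M \<in> sets M"
          using rv[of i] i by (intro measurable_sets) auto
        then show "{\<omega>\<in>space M. X i \<omega> = xs ! (i - 1)} \<in> sets M"
          by (simp add: vimage_def Int_def conj_commute)
      qed simp
      then show "steps N X -` {xs} \<inter> space M \<in> sets M" unfolding vimage by simp
    qed simp
  qed simp
  show "distr M (count_space UNIV) (steps N X) = measure_pmf (replicate_pmf N p)"
  proof (rule measure_eqI_countable[where A = UNIV])
    fix xs :: "(int ^ 'd) list"
    have "prob (steps N X -` {xs} \<inter> space M) = pmf (replicate_pmf N p) xs"
    proof (cases "length xs = N")
      case True
      have "prob {\<omega>\<in>space M. \<forall>i\<in>{1..N}. X i \<omega> = xs ! (i - 1)} = (\<Prod>i\<in>{1..N}. pmf p (xs ! (i - 1)))"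
      proof (cases "N = 0")
        case False
        have "{\<omega>\<in>space M. \<forall>i\<in>{1..N}. X i \<omega> = xs ! (i - 1)} = (\<Inter>i\<in>{1..N}. X i -` {xs ! (i - 1)} \<inter> space M)"
          using False by auto
        also have "prob \<dots> = (\<Prod>i\<in>{1..N}. prob (X i -` {xs ! (i - 1)} \<inter> space M))"
          using False by (intro indep_varsD[OF indep]) auto
        also have "\<dots> = (\<Prod>i\<in>{1..N}. pmf p (xs ! (i - 1)))"
        proof (intro prod.cong refl)
          fix i assume "i \<in> {1..N}"
          then have i: "i \<ge> 1" by simp
          have "prob (X i -` {xs ! (i - 1)} \<inter> space M) = measure (distr M (count_space UNIV) (X i)) {xs ! (i - 1)}"
            using rv[OF i] by (simp add: measure_distr)
          then show "prob (X i -` {xs ! (i - 1)} \<inter> space M) = pmf p (xs ! (i - 1))"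
            unfolding law[OF i] by (simp add: measure_pmf_single)
        qed
        finally show ?thesis .
      qed (simp add: prob_space)
      also have "\<dots> = (\<Prod>i<N. pmf p (xs ! i))"
        by (simp add: prod.atLeast1_atMost_eq)
      finally show ?thesis using True by (simp add: vimage pmf_replicate_pmf)
    next
      case False
      then have "xs \<notin> set_pmf (replicate_pmf N p)" by (simp add: set_replicate_pmf)
      then show ?thesis using False by (simp add: vimage set_pmf_iff)
    qed
    then show "emeasure (distr M (count_space UNIV) (steps N X)) {xs} = emeasure (measure_pmf (replicate_pmf N p)) {xs}"
      using meas by (simp add: emeasure_distr emeasure_eq_measure emeasure_pmf_single)
  qed auto
qed

lemma prob_steps:
  assumes "iid_steps M X p"
  shows "{\<omega>\<in>space M. steps N X \<omega> \<in> A} \<in> sets M"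
    and "measure M {\<omega>\<in>space M. steps N X \<omega> \<in> A} = measure_pmf.prob (replicate_pmf N p) A"
proof -
  have eq: "{\<omega>\<in>space M. steps N X \<omega> \<in> A} = steps N X -` A \<inter> space M" by auto
  show "{\<omega>\<in>space M. steps N X \<omega> \<in> A} \<in> sets M"
    unfolding eq by (rule measurable_sets[OF distr_steps(1)[OF assms]]) simp
  show "measure M {\<omega>\<in>space M. steps N X \<omega> \<in> A} = measure_pmf.prob (replicate_pmf N p) A"
    unfolding eq distr_steps(2)[OF assms, symmetric]
    by (rule measure_distr[OF distr_steps(1)[OF assms], symmetric]) simp
qed

lemma visits_steps_Suc:
  "visits z 0 (steps (Suc N) X \<omega>) = visits z 0 (steps N X \<omega>) + of_bool (walk X (Suc N) \<omega> = z)"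
proof -
  have "steps (Suc N) X \<omega> = steps N X \<omega> @ [X (Suc N) \<omega>]" by (simp add: steps_def)
  moreover have "walk X (Suc N) \<omega> = sum_list (steps N X \<omega>) + X (Suc N) \<omega>"
    using walk_eq_sum_list[of N N X \<omega>] by (simp add: walk_def)
  ultimately show ?thesis by (simp add: visits_append)
qed

lemma visits_steps_mono: "N \<le> N' \<Longrightarrow> visits z 0 (steps N X \<omega>) \<le> visits z 0 (steps N' X \<omega>)"
  by (rule lift_Suc_mono_le[of "\<lambda>N. visits z 0 (steps N X \<omega>)"]) (simp_all add: visits_steps_Suc)

lemma local_time_eq_SUP: "local_time X z \<omega> = (SUP N. ereal (real (visits z 0 (steps N X \<omega>))))"
proof -
  have "(\<Sum>k<N. if walk X (Suc k) \<omega> = z then 1 else 0) = ereal (real (visits z 0 (steps N X \<omega>)))" for N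
  proof (induction N)
    case 0
    show ?case by (simp add: steps_def zero_ereal_def)
  next
    case (Suc N)
    then show ?case by (simp add: visits_steps_Suc one_ereal_def)
  qed
  then show ?thesis unfolding local_time_def by (subst suminf_ereal_eq_SUP) auto
qed

lemma local_time_zeroD:
  assumes "\<not> local_time X z \<omega> > 0"
  shows "visits z 0 (steps N X \<omega>) = 0"
proof -
  have "ereal (real (visits z 0 (steps N X \<omega>))) \<le> local_time X z \<omega>"
    unfolding local_time_eq_SUP by (rule SUP_upper) simp
  also have "\<dots> \<le> 0" using assms by simp
  finally show ?thesis by (simp add: zero_ereal_def)
qed

text \<open>
  The finite visit counts are integers that increase to the local time, so a local time above \<open>m\<close>
  means at least \<open>m + 1\<close> visits within some finite time.
\<close>

lemma local_time_geD:
  assumes "ereal r \<le> local_time X z \<omega>" "real m < r"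
  shows "\<exists>N. visits z 0 (steps N X \<omega>) \<ge> Suc m"
proof -
  have "ereal (real m) < local_time X z \<omega>" using assms by (metis less_ereal.simps(1) order_less_le_trans)
  then obtain N where "ereal (real m) < ereal (real (visits z 0 (steps N X \<omega>)))"
    unfolding local_time_eq_SUP less_SUP_iff by blast
  then show ?thesis by (intro exI[of _ N]) simp
qed

section \<open>Consequences of aperiodicity, symmetry and the moment condition\<close>

text \<open>
  Every reachable point is a sum of points of the support, so a subgroup containing the support
  contains all reachable points and their differences.
\<close>

lemma generates_lattice_of_aperiodic:
  fixes p :: "(int ^ 'd) pmf"
  assumes "iid_steps M X p" "aperiodic_walk M X"
  shows "generates_lattice p"
  unfolding generates_lattice_def
proof (intro allI impI)
  fix D :: "(int ^ 'd) set"
  assume D: "0 \<in> D" "set_pmf p \<subseteq> D" "\<forall>x\<in>D. \<forall>y\<in>D. x + y \<in> D" "\<forall>x\<in>D. - x \<in> D"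
  have "reachable M X \<subseteq> D"
  proof
    fix x assume "x \<in> reachable M X"
    then obtain n where "measure M {\<omega>\<in>space M. walk X n \<omega> = x} > 0" by (auto simp: reachable_def)
    moreover have "{\<omega>\<in>space M. walk X n \<omega> = x} = {\<omega>\<in>space M. steps n X \<omega> \<in> {xs. sum_list xs = x}}"
      using walk_eq_sum_list[of n n X] by auto
    ultimately have "measure_pmf.prob (replicate_pmf n p) {xs. sum_list xs = x} > 0"
      by (simp only: prob_steps(2)[OF assms(1)])
    then have "set_pmf (replicate_pmf n p) \<inter> {xs. sum_list xs = x} \<noteq> {}"
      by (metis measure_Int_set_pmf measure_empty less_irrefl Int_commute)
    then obtain xs where xs: "set xs \<subseteq> set_pmf p" "sum_list xs = x"
      by (auto simp: set_replicate_pmf in_lists_conv_set)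
    from xs(1) have "sum_list xs \<in> D" using D by (induction xs) auto
    then show "x \<in> D" using xs(2) by simp
  qed
  moreover have "y - z \<in> D" if "y \<in> D" "z \<in> D" for y z
    using D(3,4) that by (metis diff_conv_add_uminus)
  ultimately have "{y - z | y z. y \<in> reachable M X \<and> z \<in> reachable M X} \<subseteq> D" by blast
  then show "D = UNIV" using assms(2) unfolding aperiodic_walk_def by blast
qed

text \<open>
  The escape probability is the limit of the decreasing probabilities of no return within \<open>N\<close> steps.
\<close>

lemma escape_prob_bounds:
  assumes iid: "iid_steps M X p"
  shows "hit_prob p {0} {} N 0 \<le> 1 - escape_prob M X"
    and "(\<And>n. hit_prob p {0} {} n 0 \<le> 1 - g) \<Longrightarrow> g \<le> escape_prob M X"
proof -
  interpret prob_space M using iid by (simp add: iid_steps_def)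
  define A where "A = (\<lambda>N. {\<omega>\<in>space M. steps N X \<omega> \<in> {xs. visits 0 0 xs = 0}})"
  have A: "A N \<in> sets M" for N unfolding A_def by (rule prob_steps(1)[OF iid])
  have PA: "prob (A N) = 1 - hit_prob p {0} {} N 0" for N
  proof -
    have "prob (A N) = measure_pmf.prob (replicate_pmf N p) (UNIV - {xs. visits 0 0 xs > 0})"
      unfolding A_def prob_steps(2)[OF iid] by (intro arg_cong[where f = "measure_pmf.prob _"]) auto
    also have "\<dots> = 1 - measure_pmf.prob (replicate_pmf N p) {xs. visits 0 0 xs > 0}"
      using measure_pmf.prob_compl[of "{xs. visits 0 0 xs > 0}" "replicate_pmf N p"] by simp
    finally show ?thesis by (simp only: prob_visited_eq_hit_prob)
  qed
  have "visits 0 0 (steps N X \<omega>) = 0 \<longleftrightarrow> (\<forall>i\<in>{1..N}. walk X i \<omega> \<noteq> 0)" for N \<omega>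
    by (induction N) (auto simp: steps_def[of 0] visits_steps_Suc atLeastAtMostSuc_conv)
  then have Aeq: "A N = {\<omega>\<in>space M. \<forall>i\<in>{1..N}. walk X i \<omega> \<noteq> 0}" for N by (simp add: A_def)
  have esc: "escape_prob M X = prob (\<Inter>N. A N)"
    unfolding escape_prob_def Aeq by (intro arg_cong[where f = prob]) fastforce
  show "hit_prob p {0} {} N 0 \<le> 1 - escape_prob M X"
  proof -
    have "escape_prob M X \<le> prob (A N)" unfolding esc using A by (intro finite_measure_mono) auto
    then show ?thesis by (simp add: PA)
  qed
  show "g \<le> escape_prob M X" if "\<And>n. hit_prob p {0} {} n 0 \<le> 1 - g"
  proof -
    have "decseq A" unfolding Aeq by (rule antimonoI) auto
    then have "(\<lambda>N. prob (A N)) \<longlonglongrightarrow> escape_prob M X"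
      unfolding esc using A by (intro finite_Lim_measure_decseq) auto
    then show ?thesis using that by (intro LIMSEQ_le_const) (auto simp: PA algebra_simps)
  qed
qed

text \<open>
  A step followed by its opposite.
\<close>

lemma hit_prob_two_steps_pos:
  assumes "symmetric_law p"
  shows "hit_prob p {0} {} 2 0 > 0"
proof -
  obtain x where x: "x \<in> set_pmf p" using set_pmf_not_empty by fast
  have "0 < pmf p x * pmf p (- x)"
    using x assms unfolding symmetric_law_def by (metis mult_pos_pos pmf_positive)
  also have "\<dots> = pmf (replicate_pmf 2 p) [x, - x]"
    by (subst pmf_replicate_pmf) (simp_all add: numeral_2_eq_2)
  also have "\<dots> \<le> measure_pmf.prob (replicate_pmf 2 p) {xs. visits 0 0 xs > 0}"
    unfolding pmf.rep_eq by (intro measure_pmf.finite_measure_mono) auto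
  also have "\<dots> = hit_prob p {0} {} 2 0" by (rule prob_visited_eq_hit_prob)
  finally show ?thesis .
qed

text \<open>
  Nonzero lattice points have norm at least 1, so in each dimension the function in the moment
  condition dominates a multiple of the squared norm.
\<close>

lemma integrable_second_moment:
  fixes p :: "(int ^ 'd) pmf"
  assumes dim: "CARD('d) \<ge> 3" and mom: "moment_condition p"
  shows "integrable (measure_pmf p) (\<lambda>x. (norm (real_vec x))\<^sup>2)"
proof -
  have intI: "integrable (measure_pmf p) f" if "(\<lambda>x. f x * pmf p x) summable_on UNIV" "\<And>x. 0 \<le> f x" for f :: "int ^ 'd \<Rightarrow> real"
  proof -
    have "(\<lambda>x. norm (f x * pmf p x)) summable_on UNIV"
      using that by simp
    then have "Infinite_Set_Sum.abs_summable_on (\<lambda>x. f x * pmf p x) UNIV"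
      by (simp only: abs_summable_equivalent)
    then have "integrable (count_space UNIV) (\<lambda>x. pmf p x *\<^sub>R f x)"
      by (simp add: abs_summable_on_def mult.commute)
    then show ?thesis
      unfolding measure_pmf_eq_density by (subst integrable_density) auto
  qed
  have ge1: "norm (real_vec x) = 0 \<or> 1 \<le> norm (real_vec x)" for x :: "int ^ 'd"
    using norm_real_vec_ge_1[of x] by (cases "x = 0") (auto simp: real_vec_def vec_eq_iff)
  consider "CARD('d) = 3" | "CARD('d) = 4" | "CARD('d) \<ge> 5" using dim by linarith
  then show ?thesis
  proof cases
    case 1
    then show ?thesis using mom by (intro intI) (auto simp: moment_condition_def)
  next
    case 2
    then have "integrable (measure_pmf p) (\<lambda>x. (norm (real_vec x))\<^sup>2 * ln (norm (real_vec x) + 1))"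
      using mom by (intro intI) (auto simp: moment_condition_def)
    then have "integrable (measure_pmf p) (\<lambda>x. (norm (real_vec x))\<^sup>2 * ln (norm (real_vec x) + 1) / ln 2)"
      by simp
    then show ?thesis
    proof (rule Bochner_Integration.integrable_bound)
      show "AE x in measure_pmf p. norm ((norm (real_vec x))\<^sup>2)
          \<le> norm ((norm (real_vec x))\<^sup>2 * ln (norm (real_vec x) + 1) / ln 2)"
      proof (intro AE_I2)
        fix x :: "int ^ 'd"
        show "norm ((norm (real_vec x))\<^sup>2) \<le> norm ((norm (real_vec x))\<^sup>2 * ln (norm (real_vec x) + 1) / ln 2)"
        proof (cases "norm (real_vec x) = 0")
          case False
          then have "1 \<le> norm (real_vec x)" using ge1[of x] by simp
          then have "1 \<le> ln (norm (real_vec x) + 1) / ln 2" by simp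
          then have "(norm (real_vec x))\<^sup>2 * 1 \<le> (norm (real_vec x))\<^sup>2 * (ln (norm (real_vec x) + 1) / ln 2)"
            by (intro mult_left_mono) auto
          then show ?thesis by simp
        qed simp
      qed
    qed simp
  next
    case 3
    then have "integrable (measure_pmf p) (\<lambda>x. norm (real_vec x) ^ (CARD('d) - 2))"
      using mom by (intro intI) (auto simp: moment_condition_def)
    then show ?thesis
    proof (rule Bochner_Integration.integrable_bound)
      show "AE x in measure_pmf p. norm ((norm (real_vec x))\<^sup>2) \<le> norm (norm (real_vec x) ^ (CARD('d) - 2))"
      proof (intro AE_I2)
        fix x :: "int ^ 'd"
        show "norm ((norm (real_vec x))\<^sup>2) \<le> norm (norm (real_vec x) ^ (CARD('d) - 2))"
          using ge1[of x] 3 by (auto simp: power_increasing)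
      qed
    qed simp
  qed
qed

section \<open>Lattice balls and the covariance norm\<close>

lemma card_norm_ball_le:
  assumes "0 \<le> R"
  shows "finite {x::int ^ 'd. norm (real_vec x) \<le> R}"
    and "real (card {x::int ^ 'd. norm (real_vec x) \<le> R}) \<le> (2 * R + 1) ^ CARD('d)"
proof -
  define k where "k = \<lfloor>R\<rfloor>"
  let ?F = "PiE (UNIV :: 'd set) (\<lambda>_. {-k..k})"
  have sub: "{x::int ^ 'd. norm (real_vec x) \<le> R} \<subseteq> vec_lambda ` ?F"
  proof
    fix x :: "int ^ 'd" assume "x \<in> {x. norm (real_vec x) \<le> R}"
    then have "\<bar>real_vec x $ i\<bar> \<le> R" for i using component_le_norm_cart[of "real_vec x" i] by simp
    then have "real_of_int \<bar>x $ i\<bar> \<le> R" for i by (simp add: real_vec_def)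
    then have "\<bar>x $ i\<bar> \<le> k" for i unfolding k_def by (simp add: le_floor_iff)
    then have "(\<lambda>i. x $ i) \<in> ?F" by (auto simp: abs_le_iff minus_le_iff)
    then show "x \<in> vec_lambda ` ?F" by (intro image_eqI[of _ _ "\<lambda>i. x $ i"]) auto
  qed
  have fin: "finite ?F" by (intro finite_PiE) auto
  show "finite {x::int ^ 'd. norm (real_vec x) \<le> R}"
    by (rule finite_subset[OF sub]) (use fin in simp)
  have "card {x::int ^ 'd. norm (real_vec x) \<le> R} \<le> card (vec_lambda ` ?F)"
    by (rule card_mono[OF _ sub]) (use fin in simp)
  also have "\<dots> \<le> card ?F" by (rule card_image_le[OF fin])
  also have "\<dots> = (nat (2 * k + 1)) ^ CARD('d)" by (simp add: card_PiE)
  finally have "real (card {x::int ^ 'd. norm (real_vec x) \<le> R}) \<le> real (nat (2 * k + 1)) ^ CARD('d)"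
    by (metis of_nat_le_iff of_nat_power)
  also have "\<dots> \<le> (2 * R + 1) ^ CARD('d)"
    using assms by (intro power_mono) (auto simp: k_def)
  finally show "real (card {x::int ^ 'd. norm (real_vec x) \<le> R}) \<le> (2 * R + 1) ^ CARD('d)" .
qed

lemma cov_matrix_inner:
  fixes p :: "(int ^ 'd) pmf"
  assumes sym: "symmetric_law p" and mom: "integrable (measure_pmf p) (\<lambda>x. (norm (real_vec x))\<^sup>2)"
  shows "v \<bullet> (cov_matrix p *v w) = measure_pmf.expectation p (\<lambda>x. (v \<bullet> real_vec x) * (w \<bullet> real_vec x))"
proof -
  have mean: "measure_pmf.expectation p (\<lambda>x. real_vec x $ i) = 0" for i
    using pmf_expectation_uminus[OF sym, of "\<lambda>x. real_vec x $ i"] by (simp add: real_vec_uminus)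
  have int: "integrable (measure_pmf p) (\<lambda>x. real_vec x $ i * real_vec x $ j)" for i j
  proof (rule Bochner_Integration.integrable_bound[OF mom])
    show "AE x in measure_pmf p. norm (real_vec x $ i * real_vec x $ j) \<le> norm ((norm (real_vec x))\<^sup>2)"
      by (auto simp: abs_mult power2_eq_square intro!: mult_mono component_le_norm_cart)
  qed simp
  have "v \<bullet> (cov_matrix p *v w)
      = (\<Sum>i\<in>UNIV. \<Sum>j\<in>UNIV. (v $ i * w $ j) * measure_pmf.expectation p (\<lambda>x. real_vec x $ i * real_vec x $ j))"
    by (simp add: inner_vec_def matrix_vector_mult_def cov_matrix_def mean sum_distrib_left mult_ac)
  also have "\<dots> = measure_pmf.expectation p (\<lambda>x. \<Sum>i\<in>UNIV. \<Sum>j\<in>UNIV. (v $ i * w $ j) * (real_vec x $ i * real_vec x $ j))"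
    by (simp add: Bochner_Integration.integral_sum Bochner_Integration.integrable_sum int)
  also have "\<dots> = measure_pmf.expectation p (\<lambda>x. (v \<bullet> real_vec x) * (w \<bullet> real_vec x))"
    by (simp add: inner_vec_def sum_product mult_ac)
  finally show ?thesis .
qed

text \<open>
  With \<open>Q\<close> the covariance matrix, \<open>u = Q\<^sup>-\<^sup>1 x\<close> and \<open>t = u \<bullet> Q u\<close>, which is the squared covariance norm of
  \<open>x\<close>, the Cauchy--Schwarz inequality for the form of \<open>Q\<close> bounds \<open>|x|\<^sup>2 = x \<bullet> Q u\<close> by
  \<open>x \<bullet> Q x\<close> and \<open>t\<close>, and \<open>x \<bullet> Q x\<close> is at most \<open>|x|\<^sup>2\<close> times the second moment. The matrix is invertible because a
  vector in its kernel is orthogonal to the support of the law, hence to the whole lattice.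
\<close>

lemma norm_le_cov_norm:
  fixes p :: "(int ^ 'd) pmf"
  assumes sym: "symmetric_law p" and mom: "integrable (measure_pmf p) (\<lambda>x. (norm (real_vec x))\<^sup>2)"
    and gen: "generates_lattice p"
  shows "norm x \<le> sqrt (second_moment p + 1) * cov_norm p x"
proof -
  let ?Q = "cov_matrix p"
  let ?E = "measure_pmf.expectation p"
  note inner = cov_matrix_inner[OF sym mom]
  have int: "integrable (measure_pmf p) (\<lambda>x. (v \<bullet> real_vec x)\<^sup>2)" for v
  proof (rule Bochner_Integration.integrable_bound[OF integrable_mult_right[OF mom, of "(norm v)\<^sup>2"]])
    show "AE x in measure_pmf p. norm ((v \<bullet> real_vec x)\<^sup>2) \<le> norm ((norm v)\<^sup>2 * (norm (real_vec x))\<^sup>2)"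
      by (simp add: inner_sq_le)
  qed simp
  have "w = 0" if "?Q *v w = 0" for w
  proof -
    have "?E (\<lambda>x. (w \<bullet> real_vec x)\<^sup>2) = 0"
      using inner[of w w] that by (simp add: power2_eq_square)
    then have "AE x in measure_pmf p. (w \<bullet> real_vec x)\<^sup>2 = 0"
      by (subst (asm) integral_nonneg_eq_0_iff_AE[OF int]) auto
    then have sup: "set_pmf p \<subseteq> {x. w \<bullet> real_vec x = 0}" by (auto simp: AE_measure_pmf_iff)
    have "{x. w \<bullet> real_vec x = 0} = UNIV"
    proof (rule gen[unfolded generates_lattice_def, rule_format, OF _ sup])
      have add: "real_vec (x + y) = real_vec x + real_vec y" for x y :: "int ^ 'd"
        by (simp add: real_vec_def vec_eq_iff)
      show "x + y \<in> {x. w \<bullet> real_vec x = 0}"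
        if "x \<in> {x. w \<bullet> real_vec x = 0}" "y \<in> {x. w \<bullet> real_vec x = 0}" for x y
        using that by (simp add: add inner_add_right)
      have "real_vec 0 = (0 :: real ^ 'd)" by (simp add: real_vec_def vec_eq_iff)
      then show "0 \<in> {x. w \<bullet> real_vec x = 0}" by simp
    qed (simp add: real_vec_uminus)
    then have orth: "w \<bullet> real_vec x = 0" for x by blast
    have "w $ i = 0" for i
    proof -
      have "real_vec (axis i 1) = axis i 1" by (simp add: real_vec_def axis_def vec_eq_iff)
      then show "w $ i = 0" using orth[of "axis i 1"] by (simp add: inner_axis)
    qed
    then show "w = 0" by (simp add: vec_eq_iff)
  qed
  then have "invertible ?Q"
    unfolding invertible_left_inverse matrix_left_invertible_ker by blast
  then obtain A' where "?Q ** A' = mat 1 \<and> A' ** ?Q = mat 1"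
    unfolding invertible_def by blast
  then have "?Q ** matrix_inv ?Q = mat 1 \<and> matrix_inv ?Q ** ?Q = mat 1"
    unfolding matrix_inv_def by (rule someI)
  then have Qinv: "?Q ** matrix_inv ?Q = mat 1" ..
  define u where "u = matrix_inv ?Q *v x"
  have Qu: "?Q *v u = x" by (simp add: u_def matrix_vector_mul_assoc Qinv)
  define t where "t = x \<bullet> u"
  have t: "t = ?E (\<lambda>y. (u \<bullet> real_vec y)\<^sup>2)"
    using inner[of u u] Qu by (simp add: t_def power2_eq_square inner_commute)
  define V where "V = second_moment p + 1"
  have V: "V \<ge> 1" by (simp add: V_def second_moment_def integral_nonneg_AE)
  have x2: "?E (\<lambda>y. (x \<bullet> real_vec y)\<^sup>2) \<le> (norm x)\<^sup>2 * V"
  proof -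
    have "?E (\<lambda>y. (x \<bullet> real_vec y)\<^sup>2) \<le> ?E (\<lambda>y. (norm x)\<^sup>2 * (norm (real_vec y))\<^sup>2)"
    proof (intro integral_mono int integrable_mult_right mom)
      fix y show "(x \<bullet> real_vec y)\<^sup>2 \<le> (norm x)\<^sup>2 * (norm (real_vec y))\<^sup>2"
        by (rule inner_sq_le)
    qed
    then show ?thesis
      by (simp add: V_def second_moment_def distrib_left add_increasing2)
  qed
  have "(norm x)\<^sup>2 = x \<bullet> (?Q *v u)" by (simp add: Qu power2_norm_eq_inner)
  also have "\<dots> = ?E (\<lambda>y. (x \<bullet> real_vec y) * (u \<bullet> real_vec y))" by (rule inner)
  also have "\<dots> \<le> ?E (\<lambda>y. (1 / (2 * V)) * (x \<bullet> real_vec y)\<^sup>2 + (V / 2) * (u \<bullet> real_vec y)\<^sup>2)"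
  proof (rule integral_mono)
    have "integrable (measure_pmf p) (\<lambda>y. ((x \<bullet> real_vec y)\<^sup>2 + (u \<bullet> real_vec y)\<^sup>2))"
      by (intro Bochner_Integration.integrable_add int)
    then show "integrable (measure_pmf p) (\<lambda>y. (x \<bullet> real_vec y) * (u \<bullet> real_vec y))"
    proof (rule Bochner_Integration.integrable_bound)
      have "\<bar>a * b\<bar> \<le> \<bar>a\<^sup>2 + b\<^sup>2\<bar>" for a b :: real
      proof -
        have "2 * \<bar>a * b\<bar> \<le> a\<^sup>2 + b\<^sup>2"
          using sum_squares_bound[of "\<bar>a\<bar>" "\<bar>b\<bar>"] by (simp add: abs_mult)
        then show ?thesis by linarith
      qed
      then show "AE y in measure_pmf p. norm ((x \<bullet> real_vec y) * (u \<bullet> real_vec y))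
          \<le> norm ((x \<bullet> real_vec y)\<^sup>2 + (u \<bullet> real_vec y)\<^sup>2)"
        by simp
    qed simp
    show "integrable (measure_pmf p) (\<lambda>y. (1 / (2 * V)) * (x \<bullet> real_vec y)\<^sup>2 + (V / 2) * (u \<bullet> real_vec y)\<^sup>2)"
      by (intro Bochner_Integration.integrable_add integrable_mult_right int)
    fix y
    \<comment> \<open>The weight V balances the two terms so that half of |x|^2 is absorbed on the left.\<close>
    have "0 \<le> (x \<bullet> real_vec y - V * (u \<bullet> real_vec y))\<^sup>2" by simp
    then show "(x \<bullet> real_vec y) * (u \<bullet> real_vec y)
      \<le> (1 / (2 * V)) * (x \<bullet> real_vec y)\<^sup>2 + (V / 2) * (u \<bullet> real_vec y)\<^sup>2"
      using V by (simp add: field_simps power2_eq_square)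
  qed
  also have "\<dots> = (1 / (2 * V)) * ?E (\<lambda>y. (x \<bullet> real_vec y)\<^sup>2) + (V / 2) * t"
    unfolding t by (subst Bochner_Integration.integral_add) (auto intro!: integrable_mult_right int)
  also have "\<dots> \<le> (1 / (2 * V)) * ((norm x)\<^sup>2 * V) + (V / 2) * t"
    using x2 V by (intro add_right_mono mult_left_mono) auto
  finally have "(norm x)\<^sup>2 \<le> V * t" using V by (simp add: field_simps)
  then have "norm x \<le> sqrt (V * t)" by (simp add: real_le_rsqrt)
  then show ?thesis by (simp add: real_sqrt_mult cov_norm_def V_def t_def u_def)
qed

section \<open>Returning to the origin without visiting a given point\<close>

text \<open>
  Positive by the bounded Green function, which is the transience of the walk. Smaller than 1
  because the walk can step back. Both bounds make \<open>lambda_const\<close> a genuine positive number.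
\<close>

lemma escape_prob_range:
  fixes p :: "(int ^ 'd) pmf"
  assumes dim: "CARD('d) \<ge> 3" and iid: "iid_steps M X p" and sym: "symmetric_law p" and gen: "generates_lattice p"
  shows "0 < escape_prob M X" "escape_prob M X < 1"
proof -
  obtain G where G: "G > 0" "\<And>N z. (\<Sum>n\<le>N. step_prob p z n z) \<le> G"
    using green_bounded[OF dim sym gen] by blast
  have "1 / G \<le> escape_prob M X"
    by (rule escape_prob_bounds(2)[OF iid]) (rule hit_prob_return_le[OF G(2)])
  then show "0 < escape_prob M X" using G(1) by (smt (verit) divide_pos_pos)
  show "escape_prob M X < 1"
    using escape_prob_bounds(1)[OF iid, of 2] hit_prob_two_steps_pos[OF sym] by linarith
qed

text \<open>
  The probability of a journey from the origin to \<open>z\<close>, and that of the journey back, are at least of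
  order \<open>|z|\<close> to the power \<open>2 - d\<close> by the lower bound for the Green function. The round trip
  therefore diminishes the return probability by a relative amount of order \<open>|z|\<close> to the power
  \<open>4 - 2 d\<close>, which is the source of the exponent \<open>2 d - 4\<close> in the theorem.
\<close>

lemma return_avoiding_le:
  fixes p :: "(int ^ 'd) pmf"
  assumes dim: "CARD('d) \<ge> 3" and iid: "iid_steps M X p" and sym: "symmetric_law p" and gen: "generates_lattice p"
    and mom: "integrable (measure_pmf p) (\<lambda>x. (norm (real_vec x))\<^sup>2)"
  shows "\<exists>\<kappa>>0. \<forall>z n. z \<noteq> 0 \<longrightarrow> hit_prob p {0} {z} n 0
     \<le> (1 - escape_prob M X) * exp (- \<kappa> / norm (real_vec z) ^ (2 * (CARD('d) - 2)))"
proof -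
  define g where "g = escape_prob M X"
  define e where "e = CARD('d) - 2"
  have g: "0 < g" "g < 1" using escape_prob_range[OF dim iid sym gen] by (auto simp: g_def)
  obtain G where G: "G > 0" "\<And>N z. (\<Sum>n\<le>N. step_prob p z n z) \<le> G"
    using green_bounded[OF dim sym gen] by blast
  obtain c where c: "c > 0" "\<And>y z. y \<noteq> z \<Longrightarrow> \<exists>N. c * (1 / norm (real_vec (y - z))) ^ e \<le> (\<Sum>n=1..N. step_prob p z n y)"
    using green_lower[OF dim sym gen mom] unfolding e_def by blast
  have hit: "\<exists>N. c / G * (1 / norm (real_vec (y - z))) ^ e \<le> hit_prob p {z} {} N y" if yz: "y \<noteq> z" for y z
  proof -
    obtain N where "c * (1 / norm (real_vec (y - z))) ^ e \<le> (\<Sum>n=1..N. step_prob p z n y)"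
      using c(2)[OF yz] by blast
    also have "\<dots> \<le> hit_prob p {z} {} N y * (\<Sum>n\<le>N. step_prob p z n z)"
      by (rule step_prob_sum_le_hit_prob) simp
    also have "\<dots> \<le> hit_prob p {z} {} N y * G"
      by (intro mult_left_mono G(2) hit_prob_nonneg)
    finally show ?thesis using G(1) by (intro exI[of _ N]) (simp only: times_divide_eq_left pos_divide_le_eq)
  qed
  have "hit_prob p {0} {z} n 0 \<le> (1 - g) * exp (- (g * (c / G)\<^sup>2) / norm (real_vec z) ^ (2 * e))"
    if z0: "z \<noteq> 0" for z n
  proof -
    define a where "a = c / G * (1 / norm (real_vec z)) ^ e"
    have a0: "0 \<le> a" unfolding a_def using c(1) G(1) by simp
    obtain N where N: "a \<le> hit_prob p {z} {} N 0"
      using hit[of 0 z] z0 unfolding a_def by (auto simp: real_vec_uminus)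
    obtain K where K: "a \<le> hit_prob p {0} {} K z"
      using hit[of z 0] z0 unfolding a_def by auto
    have "hit_prob p {0} {z} n 0 \<le> 1 - g - g * a * a"
      by (rule hit_prob_avoiding_le[OF _ _ _ N a0 K a0])
         (use z0 g escape_prob_bounds(1)[OF iid] in \<open>auto simp: g_def\<close>)
    also have "\<dots> \<le> (1 - g) * (1 + - (g * a\<^sup>2))"
    proof -
      have "0 \<le> g * (g * a\<^sup>2)" using g by simp
      then show ?thesis by (simp add: algebra_simps power2_eq_square)
    qed
    also have "\<dots> \<le> (1 - g) * exp (- (g * a\<^sup>2))"
      using g exp_ge_add_one_self[of "- (g * a\<^sup>2)"] by (intro mult_left_mono) auto
    also have "g * a\<^sup>2 = g * (c / G)\<^sup>2 / norm (real_vec z) ^ (2 * e)"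
      by (simp add: a_def power_mult_distrib power_divide power_mult[symmetric] mult.commute)
    finally show ?thesis by simp
  qed
  moreover have "g * (c / G)\<^sup>2 > 0" using g c(1) G(1) by simp
  ultimately show ?thesis unfolding g_def e_def by blast
qed

section \<open>Often visited sites with an unvisited neighbour\<close>

text \<open>
  The site at time \<open>j\<close> has at least \<open>m\<close> visits in total and its translate by \<open>z\<close> has none. Stated
  through all large finite horizons, the event is built from countably many events that depend on
  finitely many steps.
\<close>

definition uncovered_favourite ::
    "'a measure \<Rightarrow> (nat \<Rightarrow> 'a \<Rightarrow> int ^ 'd) \<Rightarrow> nat \<Rightarrow> int ^ 'd \<Rightarrow> nat \<Rightarrow> 'a set" where
  "uncovered_favourite M X j z m = {\<omega>\<in>space M. \<forall>\<^sub>F N in sequentially.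
     visits (walk X j \<omega>) 0 (steps N X \<omega>) \<ge> m \<and> visits (walk X j \<omega> + z) 0 (steps N X \<omega>) = 0}"

lemma prob_uncovered_favourite:
  fixes p :: "(int ^ 'd) pmf"
  assumes iid: "iid_steps M X p" and "z \<noteq> 0"
    and q: "\<And>n. hit_prob p {0} {z} n 0 \<le> q" "\<And>n. hit_prob p {0} {- z} n 0 \<le> q" "q \<le> 1"
  shows "measure M (uncovered_favourite M X j z (Suc m)) \<le> real (Suc m) * q ^ m"
    and "uncovered_favourite M X j z m' \<in> sets M"
proof -
  interpret prob_space M using iid by (simp add: iid_steps_def)
  define E where "E = (\<lambda>m. {xs. visits (sum_list (take j xs)) 0 xs \<ge> m \<and> visits (sum_list (take j xs) + z) 0 xs = 0})"
  define A where "A = (\<lambda>m N. {\<omega>\<in>space M. steps N X \<omega> \<in> E m})"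
  have A: "A m N \<in> sets M" for m N unfolding A_def by (rule prob_steps(1)[OF iid])
  define F where "F = (\<lambda>m N0. (\<Inter>N\<in>{max j N0..}. A m N))"
  have F: "F m N0 \<in> sets M" for m N0
    unfolding F_def using A by (intro sets.countable_INT) auto
  have eq: "uncovered_favourite M X j z m = (\<Union>N0. F m N0)" for m
  proof -
    have iff: "\<omega> \<in> A m N \<longleftrightarrow> \<omega> \<in> space M \<and>
         visits (walk X j \<omega>) 0 (steps N X \<omega>) \<ge> m \<and> visits (walk X j \<omega> + z) 0 (steps N X \<omega>) = 0"
      if "N \<ge> j" for N \<omega> unfolding A_def E_def using walk_eq_sum_list[OF that, of X] by simp
    show ?thesis
    proof (intro equalityI subsetI)
      fix \<omega> assume "\<omega> \<in> uncovered_favourite M X j z m"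
      then obtain N0 where "\<omega> \<in> space M" "\<And>N. N \<ge> N0 \<Longrightarrow>
         visits (walk X j \<omega>) 0 (steps N X \<omega>) \<ge> m \<and> visits (walk X j \<omega> + z) 0 (steps N X \<omega>) = 0"
        unfolding uncovered_favourite_def eventually_sequentially by blast
      then have "\<omega> \<in> F m N0" unfolding F_def by (auto simp: iff)
      then show "\<omega> \<in> (\<Union>N0. F m N0)" by blast
    next
      fix \<omega> assume "\<omega> \<in> (\<Union>N0. F m N0)"
      then obtain N0 where N0: "\<And>N. N \<ge> max j N0 \<Longrightarrow> \<omega> \<in> A m N" unfolding F_def by auto
      then have "\<omega> \<in> space M" using iff[of "max j N0" \<omega>] by simp
      moreover have "\<forall>N\<ge>max j N0. visits (walk X j \<omega>) 0 (steps N X \<omega>) \<ge> m \<and> visits (walk X j \<omega> + z) 0 (steps N X \<omega>) = 0"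
        using N0 iff by (metis max.boundedE)
      ultimately show "\<omega> \<in> uncovered_favourite M X j z m"
        unfolding uncovered_favourite_def eventually_sequentially by blast
    qed
  qed
  show "uncovered_favourite M X j z m' \<in> sets M" unfolding eq using F by (intro sets.countable_UN) auto
  have "incseq (F (Suc m))" unfolding F_def by (rule monoI) auto
  then have "(\<lambda>N0. prob (F (Suc m) N0)) \<longlonglongrightarrow> prob (uncovered_favourite M X j z (Suc m))"
    unfolding eq using F by (intro finite_Lim_measure_incseq) auto
  moreover have "prob (F (Suc m) N0) \<le> real (Suc m) * q ^ m" for N0
  proof -
    have "prob (F (Suc m) N0) \<le> prob (A (Suc m) (max j N0))"
      unfolding F_def using A by (intro finite_measure_mono) auto
    also have "\<dots> \<le> real (Suc m) * q ^ m"
      unfolding A_def prob_steps(2)[OF iid] E_def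
      by (rule prob_path_uncovered_favourite_le[OF \<open>z \<noteq> 0\<close> q]) simp
    finally show ?thesis .
  qed
  ultimately show "prob (uncovered_favourite M X j z (Suc m)) \<le> real (Suc m) * q ^ m"
    by (intro LIMSEQ_le_const2) auto
qed

text \<open>
  Here \<open>t\<close> stands for \<open>log n\<close> and \<open>m\<close> for a visit count just below \<open>k n\<close>, with \<open>exp (- L)\<close> the return
  probability. The factor \<open>exp (- L * m)\<close> is \<open>exp (- t)\<close> up to \<open>exp (\<delta> * t)\<close>, whereas avoiding a point at
  the critical distance gains twice the exponent \<open>\<kappa> / (16 * L) * t powr (1 - \<beta>)\<close>. The assumption on
  \<open>\<delta>\<close> makes the loss at most half of this gain.
\<close>

lemma block_power_le:
  fixes t s \<beta> \<kappa> L \<delta> :: real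
  assumes "L > 0" "t > 0" "0 < \<delta>" "\<delta> \<le> 1 / 2" "0 \<le> \<beta>" "\<beta> \<le> 1" "0 < s" "s \<le> 2 * t" "4 * L \<le> t" "\<kappa> > 0"
    and m: "(1 - \<delta>) * (1 / L) * t - 1 \<le> real m"
    and \<delta>: "\<delta> * t powr \<beta> \<le> \<kappa> / (16 * L)"
  shows "exp (- (L + \<kappa> / s powr \<beta>)) ^ m \<le> exp (- t) * exp (L - \<kappa> / (16 * L) * t powr (1 - \<beta>))"
proof -
  define K where "K = (1 - \<delta>) * (1 / L) * t - 1"
  define y where "y = t powr (1 - \<beta>)"
  have ty: "t = t powr \<beta> * y" unfolding y_def using assms by (simp add: powr_add[symmetric])
  have y: "y > 0" unfolding y_def using assms by simp
  have K: "t / (4 * L) \<le> K"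
  proof -
    have "(1 / 2) * ((1 / L) * t) \<le> (1 - \<delta>) * ((1 / L) * t)" using assms by (intro mult_right_mono) auto
    moreover have "1 \<le> t / (4 * L)" using assms by simp
    moreover have "(1 / 2) * ((1 / L) * t) = t / (4 * L) + t / (4 * L)" using assms by (simp add: field_simps)
    ultimately show ?thesis unfolding K_def by simp
  qed
  have sb: "s powr \<beta> \<le> 2 * t powr \<beta>"
  proof -
    have "s powr \<beta> \<le> (2 * t) powr \<beta>" using assms by (intro powr_mono2) auto
    also have "\<dots> = 2 powr \<beta> * t powr \<beta>" using assms by (simp add: powr_mult)
    also have "\<dots> \<le> 2 powr 1 * t powr \<beta>" using assms by (intro mult_right_mono powr_mono) auto
    finally show ?thesis by simp
  qed
  have "2 * (\<kappa> / (16 * L) * y) = t / (4 * L) * (\<kappa> / (2 * t powr \<beta>))"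
    using assms by (subst ty) (simp add: field_simps)
  also have "\<dots> \<le> K * (\<kappa> / s powr \<beta>)"
    using K sb assms by (intro mult_mono divide_left_mono) (auto intro: order_trans[OF _ K])
  finally have 1: "2 * (\<kappa> / (16 * L) * y) \<le> K * (\<kappa> / s powr \<beta>)" .
  have 2: "\<delta> * t \<le> \<kappa> / (16 * L) * y"
    using mult_right_mono[OF \<delta>, of y] y ty by (simp add: mult.assoc)
  have 3: "K * L = t - \<delta> * t - L" using assms by (simp add: K_def field_simps)
  have "K * (L + \<kappa> / s powr \<beta>) \<le> real m * (L + \<kappa> / s powr \<beta>)"
    using m assms unfolding K_def by (intro mult_right_mono) auto
  then have "t - L + \<kappa> / (16 * L) * y \<le> real m * (L + \<kappa> / s powr \<beta>)"
    using 1 2 3 by (simp add: distrib_left)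
  then have le: "real m * - (L + \<kappa> / s powr \<beta>) \<le> - t + (L - \<kappa> / (16 * L) * y)"
    unfolding mult_minus_right by linarith
  have "exp (- (L + \<kappa> / s powr \<beta>)) ^ m = exp (real m * - (L + \<kappa> / s powr \<beta>))"
    by (rule exp_of_nat_mult[symmetric])
  also have "\<dots> \<le> exp (- t + (L - \<kappa> / (16 * L) * y))" using le by (simp only: exp_le_cancel_iff)
  also have "\<dots> = exp (- t) * exp (L - \<kappa> / (16 * L) * y)" by (rule exp_add)
  finally show ?thesis by (simp only: y_def)
qed

lemma summable_poly_stretched_exp:
  fixes a \<nu> \<epsilon> :: real
  assumes "a > 0" "\<nu> > 0" "\<epsilon> > 0"
  shows "summable (\<lambda>l. (a * real l + 1) ^ n * exp (- \<nu> * (real l * ln 2) powr \<epsilon>))"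
proof -
  have "(\<lambda>l. (a * real l + 1) powr (real n) * exp (- \<nu> * (real l * ln 2) powr \<epsilon>)) \<in> O(\<lambda>l. 1 / real l ^ 2)"
    using assms by real_asymp
  then have "summable (\<lambda>l. (a * real l + 1) powr (real n) * exp (- \<nu> * (real l * ln 2) powr \<epsilon>))"
    by (rule summable_comparison_test_bigo[rotated]) (auto intro: inverse_power_summable[of 2, where 'a = real, simplified inverse_eq_divide])
  moreover have "(a * real l + 1) powr (real n) = (a * real l + 1) ^ n" for l
    using assms by (intro powr_realpow) (simp add: add_nonneg_pos)
  ultimately show ?thesis by simp
qed

section \<open>Dyadic blocks and the Borel--Cantelli lemma\<close>

lemma covered_radius_geI:
  assumes "r \<ge> 0" and "\<And>x. x \<in> lattice_ball p r \<Longrightarrow> local_time X (walk X j \<omega> + x) \<omega> > 0"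
  shows "ereal r \<le> covered_radius X p j \<omega>"
  unfolding covered_radius_def using assms by (intro Sup_upper) auto

text \<open>
  The theorem for \<open>\<epsilon> \<le> 1\<close>. For \<open>n\<close> in the block from \<open>2 ^ l\<close> to \<open>2 ^ (l + 1)\<close> the threshold \<open>k n\<close> is at
  least its value at the left end, and the radius is at most its value at the right end. So one
  event \<open>B l\<close> contains all failures in the block. A union bound over the \<open>2 ^ (l + 1) + 1\<close> times and the
  polynomially many (in \<open>l\<close>) displacements gives \<open>prob (B l)\<close> at most a polynomial in \<open>l\<close> times
  \<open>exp (- \<nu> * (l * ln 2) powr \<epsilon>)\<close>, which is summable.
\<close>

lemma covered_radius_lower_bound:
  fixes M :: "'a measure"
    and X :: "nat \<Rightarrow> 'a \<Rightarrow> int ^ 'd"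
    and p :: "(int ^ 'd) pmf"
  assumes dim: "CARD('d) \<ge> 3"
    and iid: "iid_steps M X p"
    and sym: "symmetric_law p"
    and gen: "generates_lattice p"
    and mom: "integrable (measure_pmf p) (\<lambda>x. (norm (real_vec x))\<^sup>2)"
    and eps: "0 < \<epsilon>" "\<epsilon> \<le> 1"
    and delta_pos: "\<And>n. \<delta> n > 0"
    and delta_dec: "decseq \<delta>"
    and delta_lim: "\<delta> \<longlonglongrightarrow> 0"
    and delta_log: "(\<lambda>n. \<delta> n * ln (real n) powr (1 - \<epsilon>)) \<longlonglongrightarrow> 0"
    and k_def: "\<And>n. k n = (1 - \<delta> n) * lambda_const M X * ln (real n)"
  shows "AE \<omega> in M. \<forall>\<^sub>F n in sequentially. \<forall>j \<in> heavy_times X k n \<omega>.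
           covered_radius X p j \<omega> \<ge> ereal (ln (real n) powr ((1 - \<epsilon>) / (2 * real CARD('d) - 4)))"
proof -
  interpret prob_space M using iid by (simp add: iid_steps_def)
  define g where "g = escape_prob M X"
  have g: "0 < g" "g < 1" using escape_prob_range[OF dim iid sym gen] by (auto simp: g_def)
  define L where "L = - ln (1 - g)"
  have L: "L > 0" using g by (simp add: L_def)
  have lam: "lambda_const M X = 1 / L" by (simp add: lambda_const_def L_def g_def)
  have expL: "exp (- L) = 1 - g" using g by (simp add: L_def)
  define D where "D = CARD('d)"
  define e where "e = D - 2"
  have e: "e \<ge> 1" "2 * real D - 4 = 2 * real e" using dim by (auto simp: e_def D_def)
  define \<beta> where "\<beta> = 1 - \<epsilon>"
  have \<beta>: "0 \<le> \<beta>" "\<beta> < 1" using eps by (auto simp: \<beta>_def)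
  define \<eta> where "\<eta> = \<beta> / (2 * real e)"
  have \<eta>: "0 \<le> \<eta>" "\<eta> \<le> 1" using \<beta> e(1) by (auto simp: \<eta>_def)
  obtain \<kappa>0 where \<kappa>0: "\<kappa>0 > 0" and avoid: "\<And>z n. z \<noteq> 0 \<Longrightarrow> hit_prob p {0} {z} n 0
     \<le> (1 - g) * exp (- \<kappa>0 / norm (real_vec z) ^ (2 * e))"
    using return_avoiding_le[OF dim iid sym gen mom] unfolding g_def e_def D_def by blast
  define C where "C = sqrt (second_moment p + 1)"
  have C: "C \<ge> 1" by (simp add: C_def second_moment_def integral_nonneg_AE)
  have ball: "norm (real_vec x) \<le> C * r" if "x \<in> lattice_ball p r" for x r
  proof -
    have "norm (real_vec x) \<le> C * cov_norm p (real_vec x)"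
      unfolding C_def by (rule norm_le_cov_norm[OF sym mom gen])
    also have "\<dots> \<le> C * r" using that C by (intro mult_left_mono) (auto simp: lattice_ball_def)
    finally show ?thesis .
  qed
  define \<kappa> where "\<kappa> = \<kappa>0 / C ^ (2 * e)"
  have \<kappa>: "\<kappa> > 0" using \<kappa>0 C by (simp add: \<kappa>_def)
  define \<nu> where "\<nu> = \<kappa> / (16 * L)"
  have \<nu>: "\<nu> > 0" using \<kappa> L by (simp add: \<nu>_def)

  \<comment> \<open>The logarithms of the two ends of the block with number l.\<close>
  define t where "t = (\<lambda>l::nat. real l * ln 2)"
  define s where "s = (\<lambda>l::nat. real (Suc l) * ln 2)"
  have s: "s l > 0" for l by (simp add: s_def)
  have st: "s l \<le> 2 * t l" if "l \<ge> 1" for l using that by (simp add: s_def t_def)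
  define q where "q = (\<lambda>l. exp (- (L + \<kappa> / s l powr \<beta>)))"
  define Z where "Z = (\<lambda>l. {z::int ^ 'd. z \<noteq> 0 \<and> norm (real_vec z) \<le> C * s l powr \<eta>})"
  have hit: "hit_prob p {0} {z} n 0 \<le> q l" if z: "z \<in> Z l" for z n l
  proof -
    have z': "z \<noteq> 0" "norm (real_vec z) \<le> C * s l powr \<eta>" using z by (auto simp: Z_def)
    have nz: "norm (real_vec z) \<ge> 1" by (rule norm_real_vec_ge_1[OF z'(1)])
    have "norm (real_vec z) ^ (2 * e) \<le> (C * s l powr \<eta>) ^ (2 * e)" using z'(2) by (intro power_mono) auto
    also have "\<dots> = C ^ (2 * e) * s l powr \<beta>"
    proof -
      have "(s l powr \<eta>) ^ (2 * e) = (s l powr \<eta>) powr real (2 * e)"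
        by (rule powr_realpow[symmetric]) (use s[of l] in simp)
      also have "\<dots> = s l powr (\<eta> * real (2 * e))" by (rule powr_powr)
      also have "\<eta> * real (2 * e) = \<beta>" using e(1) by (simp add: \<eta>_def)
      finally show ?thesis by (simp add: power_mult_distrib)
    qed
    finally have "\<kappa>0 / (C ^ (2 * e) * s l powr \<beta>) \<le> \<kappa>0 / norm (real_vec z) ^ (2 * e)"
      using nz \<kappa>0 by (intro divide_left_mono mult_pos_pos zero_less_power) (use C s[of l] in auto)
    then have "\<kappa> / s l powr \<beta> \<le> \<kappa>0 / norm (real_vec z) ^ (2 * e)" by (simp add: \<kappa>_def)
    then have "exp (- \<kappa>0 / norm (real_vec z) ^ (2 * e)) \<le> exp (- (\<kappa> / s l powr \<beta>))" by simp
    then have "(1 - g) * exp (- \<kappa>0 / norm (real_vec z) ^ (2 * e)) \<le> (1 - g) * exp (- (\<kappa> / s l powr \<beta>))"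
      using g by (intro mult_left_mono) auto
    also have "\<dots> = q l" by (simp add: q_def expL[symmetric] exp_add[symmetric])
    finally show ?thesis using avoid[OF z'(1), of n] by linarith
  qed
  have Zminus: "- z \<in> Z l" if "z \<in> Z l" for z l using that by (simp add: Z_def real_vec_uminus)
  have q1: "q l \<le> 1" for l
  proof -
    have "0 \<le> \<kappa> / s l powr \<beta>" using \<kappa> by simp
    then show ?thesis using L by (simp add: q_def)
  qed

  \<comment> \<open>The largest integer strictly below the threshold, so that a heavy site has at least
    m l + 1 visits.\<close>
  define m where "m = (\<lambda>l. nat (\<lceil>k (2 ^ l)\<rceil> - 1))"
  define B where "B = (\<lambda>l. \<Union>j\<in>{..2 ^ Suc l}. \<Union>z\<in>Z l. uncovered_favourite M X j z (Suc (m l)))"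
  have finZ: "finite (Z l)" and cardZ: "real (card (Z l)) \<le> (2 * (C * s l powr \<eta>) + 1) ^ D" for l
  proof -
    have sub: "Z l \<subseteq> {z. norm (real_vec z) \<le> C * s l powr \<eta>}" by (auto simp: Z_def)
    have R: "0 \<le> C * s l powr \<eta>" using C by simp
    show "finite (Z l)" by (rule finite_subset[OF sub card_norm_ball_le(1)[OF R]])
    have "card (Z l) \<le> card {z::int ^ 'd. norm (real_vec z) \<le> C * s l powr \<eta>}"
      by (rule card_mono[OF card_norm_ball_le(1)[OF R] sub])
    then show "real (card (Z l)) \<le> (2 * (C * s l powr \<eta>) + 1) ^ D"
      unfolding D_def using card_norm_ball_le(2)[OF R, where 'd = 'd] by linarith
  qed
  have un: "prob (uncovered_favourite M X j z (Suc (m l))) \<le> real (Suc (m l)) * q l ^ m l"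
      "uncovered_favourite M X j z (Suc (m l)) \<in> sets M" if "z \<in> Z l" for j z l
    using prob_uncovered_favourite[OF iid _ hit[OF that] hit[OF Zminus[OF that]] q1] that
    by (auto simp: Z_def)
  have Bsets: "B l \<in> sets M" for l
    unfolding B_def using finZ un(2) by (intro sets.finite_UN) auto
  have PB: "prob (B l) \<le> (2 ^ Suc l + 1) * (real (card (Z l)) * (real (Suc (m l)) * q l ^ m l))" for l
  proof -
    have "prob (B l) \<le> (\<Sum>j\<in>{..2 ^ Suc l::nat}. prob (\<Union>z\<in>Z l. uncovered_favourite M X j z (Suc (m l))))"
      unfolding B_def using finZ un(2) by (intro finite_measure_subadditive_finite) (auto intro!: sets.finite_UN)
    also have "\<dots> \<le> (\<Sum>j\<in>{..2 ^ Suc l::nat}. \<Sum>z\<in>Z l. prob (uncovered_favourite M X j z (Suc (m l))))"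
      using finZ un(2) by (intro sum_mono finite_measure_subadditive_finite) auto
    also have "\<dots> \<le> (\<Sum>j\<in>{..2 ^ Suc l::nat}. \<Sum>z\<in>Z l. real (Suc (m l)) * q l ^ m l)"
      by (intro sum_mono un(1))
    also have "\<dots> = (2 ^ Suc l + 1) * (real (card (Z l)) * (real (Suc (m l)) * q l ^ m l))"
      by (simp add: add.commute)
    finally show ?thesis .
  qed

  have two_pow: "filterlim (\<lambda>l. (2::nat) ^ l) sequentially sequentially"
    by (intro filterlim_subseq) (auto simp: strict_mono_def)
  have ln2: "ln (real (2 ^ l)) = t l" for l by (simp add: t_def ln_realpow)
  have ev1: "\<forall>\<^sub>F l in sequentially. \<delta> (2 ^ l) \<le> 1 / 2"
  proof -
    have "\<forall>\<^sub>F n in sequentially. \<delta> n < 1 / 2" using delta_lim by (rule order_tendstoD) simp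
    then have "\<forall>\<^sub>F l in sequentially. \<delta> (2 ^ l) < 1 / 2"
      using two_pow by (rule eventually_compose_filterlim)
    then show ?thesis by eventually_elim simp
  qed
  have ev2: "\<forall>\<^sub>F l in sequentially. \<delta> (2 ^ l) * t l powr \<beta> \<le> \<nu>"
  proof -
    have "\<forall>\<^sub>F n in sequentially. \<delta> n * ln (real n) powr (1 - \<epsilon>) < \<nu>"
      using delta_log by (rule order_tendstoD) (rule \<nu>)
    then have "\<forall>\<^sub>F l in sequentially. \<delta> (2 ^ l) * ln (real (2 ^ l)) powr (1 - \<epsilon>) < \<nu>"
      using two_pow by (rule eventually_compose_filterlim)
    then show ?thesis unfolding ln2 \<beta>_def by eventually_elim simp
  qed
  have ev3: "\<forall>\<^sub>F l in sequentially. 4 * L \<le> t l" and ev4: "\<forall>\<^sub>F l in sequentially. 1 \<le> l"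
    unfolding t_def by (real_asymp, rule eventually_ge_at_top)

  define a where "a = max (4 * C) (1 / L)"
  have a: "a > 0" unfolding a_def using C by simp
  have "summable (\<lambda>l. prob (B l))"
  proof (rule summable_comparison_test_ev)
    show "summable (\<lambda>l. 3 * exp L * ((a * real l + 1) ^ Suc D * exp (- \<nu> * (real l * ln 2) powr \<epsilon>)))"
      by (intro summable_mult summable_poly_stretched_exp a \<nu> eps)
    show "\<forall>\<^sub>F l in sequentially. norm (prob (B l))
       \<le> 3 * exp L * ((a * real l + 1) ^ Suc D * exp (- \<nu> * (real l * ln 2) powr \<epsilon>))"
      using ev1 ev2 ev3 ev4
    proof eventually_elim
      case (elim l)
      have tl: "0 < t l" "t l \<le> real l" using elim(4) by (auto simp: t_def ln_2_less_1 mult_left_le less_imp_le)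
      have kl: "k (2 ^ l) = (1 - \<delta> (2 ^ l)) * (1 / L) * t l"
        unfolding k_def lam ln2 by simp
      have kpos: "0 < k (2 ^ l)" unfolding kl using elim(1) L tl(1) by (intro mult_pos_pos) auto
      have m_ge: "k (2 ^ l) - 1 \<le> real (m l)" and m_le: "real (m l) \<le> k (2 ^ l)"
        unfolding m_def using kpos by linarith+
      have "q l ^ m l \<le> exp (- t l) * exp (L - \<nu> * t l powr (1 - \<beta>))"
        unfolding q_def \<nu>_def
        by (rule block_power_le[where \<delta> = "\<delta> (2 ^ l)"])
           (use L tl(1) delta_pos elim \<beta> s st \<kappa> m_ge kl \<nu>_def in auto)
      also have "\<dots> = exp L * (exp (- t l) * exp (- \<nu> * t l powr \<epsilon>))"
        by (simp add: exp_add[symmetric] \<beta>_def)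
      finally have qm: "q l ^ m l \<le> exp L * (exp (- t l) * exp (- \<nu> * t l powr \<epsilon>))" .
      have et: "(2 ^ Suc l + 1) * exp (- t l) \<le> 3"
      proof -
        have "exp (t l) = 2 ^ l" by (simp add: t_def exp_of_nat_mult)
        then have "exp (- t l) = 1 / 2 ^ l" by (simp add: exp_minus divide_inverse)
        then have "(2 ^ Suc l + 1) * exp (- t l) = 2 + 1 / 2 ^ l" by (simp add: add_divide_distrib)
        moreover have "1 / 2 ^ l \<le> (1::real)" by simp
        ultimately show ?thesis by linarith
      qed
      have card: "real (card (Z l)) \<le> (a * real l + 1) ^ D"
      proof -
        have "s l powr \<eta> \<le> 2 * real l"
        proof -
          have "1 \<le> s l"
          proof -
            have "1 \<le> 2 * ln (2::real)" using ln2_ge_two_thirds by simp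
            also have "\<dots> \<le> s l" unfolding s_def using elim(4) by (intro mult_right_mono) auto
            finally show ?thesis .
          qed
          then have "s l powr \<eta> \<le> s l powr 1" using \<eta>(2) by (intro powr_mono) auto
          also have "\<dots> \<le> 2 * real l" using st[OF elim(4)] tl(2) \<open>1 \<le> s l\<close> by simp
          finally show ?thesis .
        qed
        then have "2 * (C * s l powr \<eta>) \<le> 2 * (C * (2 * real l))" using C by (intro mult_left_mono) auto
        also have "\<dots> = 4 * C * real l" by simp
        also have "\<dots> \<le> a * real l" unfolding a_def by (intro mult_right_mono) auto
        finally show ?thesis using cardZ[of l] C
          by (intro order_trans[OF cardZ] power_mono) auto
      qed
      have mSuc: "real (Suc (m l)) \<le> a * real l + 1"
      proof -
        have "real (m l) \<le> (1 - \<delta> (2 ^ l)) * (1 / L) * t l" using m_le by (simp only: kl)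
        also have "\<dots> \<le> 1 * (1 / L) * real l"
          by (intro mult_mono) (use less_imp_le[OF delta_pos[of "2 ^ l"]] L tl in auto)
        also have "\<dots> \<le> a * real l" unfolding a_def by (intro mult_right_mono) auto
        finally show ?thesis by simp
      qed
      have "prob (B l) \<le> (2 ^ Suc l + 1) * (real (card (Z l)) * (real (Suc (m l)) * q l ^ m l))" by (rule PB)
      also have "\<dots> \<le> (2 ^ Suc l + 1) * ((a * real l + 1) ^ D * ((a * real l + 1) *
            (exp L * (exp (- t l) * exp (- \<nu> * t l powr \<epsilon>)))))"
        using card mSuc qm a by (intro mult_left_mono mult_mono) (auto simp: q_def)
      also have "\<dots> = ((2 ^ Suc l + 1) * exp (- t l)) * (exp L * ((a * real l + 1) ^ Suc D * exp (- \<nu> * t l powr \<epsilon>)))"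
        by (simp only: power_Suc mult_ac)
      also have "\<dots> \<le> 3 * (exp L * ((a * real l + 1) ^ Suc D * exp (- \<nu> * t l powr \<epsilon>)))"
        using a by (intro mult_right_mono[OF et]) auto
      finally show ?case by (simp add: t_def mult.assoc)
    qed
  qed
  then have "AE \<omega> in M. \<forall>\<^sub>F l in sequentially. \<omega> \<in> space M - B l"
    by (intro borel_cantelli_AE1 Bsets) (auto simp: emeasure_eq_measure)
  then show ?thesis
  proof eventually_elim
    case (elim \<omega>)
    have "\<forall>\<^sub>F l in sequentially. \<omega> \<in> space M - B l \<and> \<delta> (2 ^ l) \<le> 1 / 2 \<and> 4 * L \<le> t l"
      using elim ev1 ev3 by eventually_elim simp
    then obtain l0 where l0: "\<And>l. l \<ge> l0 \<Longrightarrow> \<omega> \<in> space M - B l \<and> \<delta> (2 ^ l) \<le> 1 / 2 \<and> 4 * L \<le> t l"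
      unfolding eventually_sequentially by blast
    have "ereal (ln (real n) powr \<eta>) \<le> covered_radius X p j \<omega>"
      if n: "n \<ge> 2 ^ l0" and j: "j \<in> heavy_times X k n \<omega>" for n j
    proof (rule covered_radius_geI)
      have "n \<ge> 1" using n by (meson one_le_numeral one_le_power order_trans)
      then obtain l where l: "2 ^ l \<le> n" "n < 2 ^ (l + 1)"
        using ex_power_ivl1[of 2 n] by auto
      have "l \<ge> l0"
      proof (rule ccontr)
        assume "\<not> l \<ge> l0"
        then have "(2::nat) ^ (l + 1) \<le> 2 ^ l0" by (intro power_increasing) auto
        then show False using l(2) n by simp
      qed
      note l0 = l0[OF this]
      have ln_n: "t l \<le> ln (real n)" "ln (real n) \<le> s l" "ln (real n) \<ge> 0"
      proof -
        have "real (2 ^ l) \<le> real n" using l(1) by (simp only: of_nat_le_iff)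
        then show "t l \<le> ln (real n)" unfolding ln2[symmetric] using \<open>n \<ge> 1\<close> by (intro ln_mono) auto
        have "real n \<le> real (2 ^ Suc l)" using l(2) by (simp only: of_nat_le_iff Suc_eq_plus1 less_imp_le)
        then have "ln (real n) \<le> ln (real (2 ^ Suc l))" using \<open>n \<ge> 1\<close> by (intro ln_mono) auto
        then show "ln (real n) \<le> s l" unfolding ln2 by (simp add: s_def t_def)
        show "ln (real n) \<ge> 0" using \<open>n \<ge> 1\<close> by simp
      qed
      have tl: "t l > 0" using l0 L by linarith
      have kl: "k (2 ^ l) = (1 - \<delta> (2 ^ l)) * (1 / L) * t l"
        unfolding k_def lam ln2 by simp
      have kpos: "0 < k (2 ^ l)" unfolding kl using l0 L tl by (intro mult_pos_pos) auto
      have kn_eq: "k n = (1 - \<delta> n) * (1 / L) * ln (real n)" unfolding k_def lam ..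
      have kn: "k (2 ^ l) \<le> k n"
        unfolding kl kn_eq using decseqD[OF delta_dec l(1)] ln_n L l0 tl
        by (intro mult_mono mult_right_mono) auto
      have heavy: "ereal (k n) \<le> local_time X (walk X j \<omega>) \<omega>" and jn: "j \<le> n"
        using j by (auto simp: heavy_times_def)
      fix x assume x: "x \<in> lattice_ball p (ln (real n) powr \<eta>)"
      show "0 < local_time X (walk X j \<omega> + x) \<omega>"
      proof (rule ccontr)
        assume neg: "\<not> 0 < local_time X (walk X j \<omega> + x) \<omega>"
        have "x \<noteq> 0"
        proof
          assume "x = 0"
          have "(0::ereal) < ereal (k n)" using kpos kn by (simp add: zero_ereal_def)
          then show False using neg heavy \<open>x = 0\<close> by (metis add.right_neutral order_less_le_trans)
        qed
        moreover have "norm (real_vec x) \<le> C * s l powr \<eta>"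
        proof -
          have "norm (real_vec x) \<le> C * ln (real n) powr \<eta>" by (rule ball[OF x])
          also have "\<dots> \<le> C * s l powr \<eta>"
            using ln_n \<eta> C by (intro mult_left_mono powr_mono2) auto
          finally show ?thesis .
        qed
        ultimately have xZ: "x \<in> Z l" by (simp add: Z_def)
        have "real (m l) < k n" using kpos kn unfolding m_def by linarith
        then obtain N0 where N0: "visits (walk X j \<omega>) 0 (steps N0 X \<omega>) \<ge> Suc (m l)"
          using local_time_geD[OF heavy] by blast
        have "visits (walk X j \<omega>) 0 (steps N X \<omega>) \<ge> Suc (m l) \<and> visits (walk X j \<omega> + x) 0 (steps N X \<omega>) = 0"
          if "N \<ge> N0" for N
          using order_trans[OF N0 visits_steps_mono[OF that]] local_time_zeroD[OF neg] by simp
        then have "\<omega> \<in> uncovered_favourite M X j x (Suc (m l))"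
          using l0 unfolding uncovered_favourite_def eventually_sequentially by blast
        moreover have "j \<in> {..2 ^ Suc l}" using jn l(2) by simp
        ultimately have "\<omega> \<in> B l" unfolding B_def using xZ by blast
        then show False using l0 by simp
      qed
    qed simp
    then show ?case
      unfolding eventually_sequentially \<eta>_def e(2)[symmetric] \<beta>_def D_def by blast
  qed
qed

theorem corollary1p2:
  fixes M :: "'a measure"
    and X :: "nat \<Rightarrow> 'a \<Rightarrow> int ^ 'd"
    and p :: "(int ^ 'd) pmf"
    and \<epsilon> :: real
    and \<delta> :: "nat \<Rightarrow> real"
    and k :: "nat \<Rightarrow> real"
  assumes dim: "CARD('d) \<ge> 3"
    and iid: "iid_steps M X p"
    and sym: "symmetric_law p"
    and aper: "aperiodic_walk M X"
    and moment: "moment_condition p"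
    and eps: "\<epsilon> > 0"
    and delta_pos: "\<And>n. \<delta> n > 0"
    and delta_dec: "decseq \<delta>"
    and delta_lim: "\<delta> \<longlonglongrightarrow> 0"
    and delta_log: "(\<lambda>n. \<delta> n * ln (real n) powr (1 - \<epsilon>)) \<longlonglongrightarrow> 0"
    and k_def: "\<And>n. k n = (1 - \<delta> n) * lambda_const M X * ln (real n)"
  shows "AE \<omega> in M. \<forall>\<^sub>F n in sequentially. \<forall>j \<in> heavy_times X k n \<omega>.
           covered_radius X p j \<omega> \<ge> ereal (ln (real n) powr ((1 - \<epsilon>) / (2 * real CARD('d) - 4)))"
proof -
  \<comment> \<open>For \<epsilon> > 1 the exponent of the radius is negative, so the assertion for 1 is stronger as soon as
    the logarithm is at least 1.\<close>
  define \<epsilon>' where "\<epsilon>' = min \<epsilon> 1"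
  have log': "(\<lambda>n. \<delta> n * ln (real n) powr (1 - \<epsilon>')) \<longlonglongrightarrow> 0"
  proof (cases "\<epsilon> \<le> 1")
    case True
    then show ?thesis using delta_log by (simp add: \<epsilon>'_def)
  next
    case False
    then have "1 - \<epsilon>' = 0" by (simp add: \<epsilon>'_def)
    have "\<forall>\<^sub>F n in sequentially. \<delta> n = \<delta> n * ln (real n) powr (1 - \<epsilon>')"
      using eventually_ge_at_top[of "2::nat"]
      by eventually_elim (simp add: \<open>1 - \<epsilon>' = 0\<close>)
    then show ?thesis using delta_lim by (rule Lim_transform_eventually[rotated])
  qed
  have exponent: "(1 - \<epsilon>) / (2 * real CARD('d) - 4) \<le> (1 - \<epsilon>') / (2 * real CARD('d) - 4)"
    using dim by (intro divide_right_mono) (auto simp: \<epsilon>'_def)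
  have "AE \<omega> in M. \<forall>\<^sub>F n in sequentially. \<forall>j \<in> heavy_times X k n \<omega>.
           covered_radius X p j \<omega> \<ge> ereal (ln (real n) powr ((1 - \<epsilon>') / (2 * real CARD('d) - 4)))"
    by (rule covered_radius_lower_bound[OF dim iid sym generates_lattice_of_aperiodic[OF iid aper]
          integrable_second_moment[OF dim moment] _ _ delta_pos delta_dec delta_lim log' k_def])
       (use eps in \<open>auto simp: \<epsilon>'_def\<close>)
  then show ?thesis
  proof eventually_elim
    case (elim \<omega>)
    have "\<forall>\<^sub>F n in sequentially. 1 \<le> ln (real n)" by real_asymp
    with elim show ?case
    proof eventually_elim
      case (elim n)
      have "ereal (ln (real n) powr ((1 - \<epsilon>) / (2 * real CARD('d) - 4)))
          \<le> ereal (ln (real n) powr ((1 - \<epsilon>') / (2 * real CARD('d) - 4)))"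
        using elim(2) exponent by (simp add: powr_mono)
      then show ?case using elim(1) order_trans by blast
    qed
  qed
qed

end
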